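(* Let $\mathcal{P}$ be a set of probability distributions on $\mathcal{Z}=\mathcal{X}\times\mathcal{Y}$ containing a hypercube of distributions characterized by its dimension $m$, its edge probability $w$ and its edge discrepancies $d_{\mathrm{I}}$ and $d_{\mathrm{II}}$. For any estimator $\hat g$ and training set size $n\in\mathbb{N}^*$, the following assertions hold: 1. We have $$\sup_{P\in\mathcal{P}}\left\{\mathbb{E}R(\hat g)-\min_gR(g)\right\}\ge mwd_{\mathrm{I}}\left(1-\sqrt{1-[1-d_{\mathrm{II}}]^{nw}}\right)\ge mwd_{\mathrm{I}}\left(1-\sqrt{nwd_{\mathrm{II}}}\right).$$ 2. When the hypercube satisfies $p_+=1=1-p_-$, we also have $$\sup_{P\in\mathcal{P}}\left\{\mathbb{E}R(\hat g)-\min_gR(g)\right\}\ge mwd_{\mathrm{I}}(1-w)^n.$$ Here the minimum is taken over the space of all prediction functions.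
   Context: Setting. The loss is of the form $L[(x,y),g]=\ell[y,g(x)]$ for some function $\ell:\mathcal{Y}\times\mathcal{Y}\to\mathbb{R}$. Prediction functions are measurable functions $\mathcal{X}\to\mathcal{Y}$; $R(g)=\mathbb{E}_{(X,Y)\sim P}\ell[Y,g(X)]$. An estimator $\hat g$ maps a training set $Z_1^n\in\mathcal{Z}^n$ to a prediction function $\hat g_{Z_1^n}$ (measurability is implicitly assumed), and $\mathbb{E}R(\hat g)=\mathbb{E}_{Z_1^n\sim P^{\otimes n}}R(\hat g_{Z_1^n})$. Hypercube. Let $m\in\mathbb{N}^*$. A hypercube of probability distributions of dimension $m$ is a family of $2^m$ distributions $\{P_{\bar\sigma}:\bar\sigma=(\sigma_1,\dots,\sigma_m)\in\{-;+\}^m\}$ on $\mathcal{Z}$ having the same first marginal $P_{\bar\sigma}(dX)=\mu(dX)$ and such that there exist a partition $\mathcal{X}_0,\dots,\mathcal{X}_m$ of $\mathcal{X}$ with $\mu(\mathcal{X}_1)=\dots=\mu(\mathcal{X}_m)$, elements $h_1\ne h_2$ of $\mathcal{Y}$, and reals $0\le p_-<p_+\le1$, for which for any $j\in\{1,\dots,m\}$ and $x\in\mathcal{X}_j$, $P_{\bar\sigma}(Y=h_1|X=x)=p_{\sigma_j}=1-P_{\bar\sigma}(Y=h_2|X=x)$, and for any $x\in\mathcal{X}_0$ the distribution of $Y$ knowing $X=x$ is independent of $\bar\sigma$. The edge probability is $w=\mu(\mathcal{X}_1)=\dots=\mu(\mathcal{X}_m)$. Edge discrepancies. For $p\in[0;1]$,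 let $\phi(p)=\inf_{y\in\mathcal{Y}}\{p\,\ell(h_1,y)+(1-p)\,\ell(h_2,y)\}$. For $q_+,q_-\in[0;1]$, $\psi_{q_+,q_-}(\alpha)=\phi[\alpha q_++(1-\alpha)q_-]-\alpha\phi(q_+)-(1-\alpha)\phi(q_-)$. The edge discrepancy of type I is $d_{\mathrm{I}}=\psi_{p_+,p_-}(1/2)$; the edge discrepancy of type II is $d_{\mathrm{II}}=\left(\sqrt{p_+(1-p_-)}-\sqrt{(1-p_+)p_-}\right)^2$.
   Formalization: The second inequality of the chain in assertion 1 fails when 0 < nw < 1 and d_I > 0, so it is asserted only for nw ≥ 1; both expressions are shown to be lower bounds on the supremum without restriction. *)

theory Defs
  imports "HOL-Probability.Probability"
begin

(* Expectation of an extended-real function: mean of the positive part minus mean of the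
   negative part. In ereal, \<infinity> - \<infinity> = \<infinity>, so an expectation that does not exist counts
   as \<infinity>; whenever it exists in [-\<infinity>, \<infinity>] this is the usual value. *)
definition extended_expectation :: "'a measure \<Rightarrow> ('a \<Rightarrow> ereal) \<Rightarrow> ereal" where
  "extended_expectation M f =
     enn2ereal (\<integral>\<^sup>+ x. e2ennreal (f x) \<partial>M) - enn2ereal (\<integral>\<^sup>+ x. e2ennreal (- f x) \<partial>M)"

definition risk :: "('y \<Rightarrow> 'y \<Rightarrow> real) \<Rightarrow> ('x \<times> 'y) measure \<Rightarrow> ('x \<Rightarrow> 'y) \<Rightarrow> ereal" where
  "risk l P g = extended_expectation P (\<lambda>(x, y). ereal (l y (g x)))"

(* Joint measurability in the training set and the input. *)
definition estimator ::
  "'x measure \<Rightarrow> 'y measure \<Rightarrow> nat \<Rightarrow> ((nat \<Rightarrow> 'x \<times> 'y) \<Rightarrow> 'x \<Rightarrow> 'y) \<Rightarrow> bool" where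
  "estimator MX MY n ghat \<longleftrightarrow>
     (\<lambda>(z, x). ghat z x) \<in> (PiM {..<n} (\<lambda>_. MX \<Otimes>\<^sub>M MY)) \<Otimes>\<^sub>M MX \<rightarrow>\<^sub>M MY"

definition expected_risk ::
  "('y \<Rightarrow> 'y \<Rightarrow> real) \<Rightarrow> nat \<Rightarrow> ('x \<times> 'y) measure \<Rightarrow> ((nat \<Rightarrow> 'x \<times> 'y) \<Rightarrow> 'x \<Rightarrow> 'y) \<Rightarrow> ereal" where
  "expected_risk l n P ghat =
     extended_expectation (PiM {..<n} (\<lambda>_. P)) (\<lambda>z. risk l P (ghat z))"

(* The infimum over all prediction functions; it is the minimum whenever that is attained. *)
definition minimal_risk ::
  "'x measure \<Rightarrow> 'y measure \<Rightarrow> ('y \<Rightarrow> 'y \<Rightarrow> real) \<Rightarrow> ('x \<times> 'y) measure \<Rightarrow> ereal" where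
  "minimal_risk MX MY l P = (INF g \<in> MX \<rightarrow>\<^sub>M MY. risk l P g)"

(* K x is the distribution of Y knowing X = x, for (X, Y) distributed according to P. *)
definition conditional_distribution ::
  "'x measure \<Rightarrow> 'y measure \<Rightarrow> ('x \<times> 'y) measure \<Rightarrow> ('x \<Rightarrow> 'y measure) \<Rightarrow> bool" where
  "conditional_distribution MX MY P K \<longleftrightarrow>
     K \<in> MX \<rightarrow>\<^sub>M prob_algebra MY \<and>
     (\<forall>A \<in> sets MX. \<forall>B \<in> sets MY.
        emeasure P (A \<times> B) = (\<integral>\<^sup>+ x \<in> A. emeasure (K x) B \<partial>(distr P MX fst)))"

(* The index set {-; +}^m, with True for + and False for -. *)
definition sign_vectors :: "nat \<Rightarrow> (nat \<Rightarrow> bool) set" where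
  "sign_vectors m = {1..m} \<rightarrow>\<^sub>E UNIV"

(* The cells XX 0, ..., XX m form the partition of the input space (cells may be empty);
   w is the edge probability. *)
definition hypercube ::
  "'x measure \<Rightarrow> 'y measure \<Rightarrow> nat \<Rightarrow> ((nat \<Rightarrow> bool) \<Rightarrow> ('x \<times> 'y) measure) \<Rightarrow> 'x measure \<Rightarrow>
   (nat \<Rightarrow> 'x set) \<Rightarrow> 'y \<Rightarrow> 'y \<Rightarrow> real \<Rightarrow> real \<Rightarrow> real \<Rightarrow> bool" where
  "hypercube MX MY m Ps \<mu> XX h1 h2 p_plus p_minus w \<longleftrightarrow>
     m \<ge> 1 \<and>
     (\<forall>\<sigma> \<in> sign_vectors m.
        prob_space (Ps \<sigma>) \<and> sets (Ps \<sigma>) = sets (MX \<Otimes>\<^sub>M MY) \<and> distr (Ps \<sigma>) MX fst = \<mu>) \<and>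
     (\<forall>j \<le> m. XX j \<in> sets MX) \<and> disjoint_family_on XX {..m} \<and> (\<Union>j \<le> m. XX j) = space MX \<and>
     (\<forall>j \<in> {1..m}. measure \<mu> (XX j) = w) \<and>
     h1 \<in> space MY \<and> h2 \<in> space MY \<and> h1 \<noteq> h2 \<and>
     0 \<le> p_minus \<and> p_minus < p_plus \<and> p_plus \<le> 1 \<and>
     (\<exists>K. (\<forall>\<sigma> \<in> sign_vectors m. conditional_distribution MX MY (Ps \<sigma>) (K \<sigma>)) \<and>
          (\<forall>\<sigma> \<in> sign_vectors m. \<forall>j \<in> {1..m}. \<forall>x \<in> XX j.
             measure (K \<sigma> x) {h1} = (if \<sigma> j then p_plus else p_minus) \<and>
             1 - measure (K \<sigma> x) {h2} = (if \<sigma> j then p_plus else p_minus)) \<and>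
          (\<forall>\<sigma> \<in> sign_vectors m. \<forall>\<tau> \<in> sign_vectors m. \<forall>x \<in> XX 0. K \<sigma> x = K \<tau> x))"

(* Extended-real valued, since the infimum may be -\<infinity> for a loss that is unbounded below. *)
definition \<phi> :: "'y measure \<Rightarrow> ('y \<Rightarrow> 'y \<Rightarrow> real) \<Rightarrow> 'y \<Rightarrow> 'y \<Rightarrow> real \<Rightarrow> ereal" where
  "\<phi> MY l h1 h2 p = (INF y \<in> space MY. ereal (p * l h1 y + (1 - p) * l h2 y))"

definition \<psi> ::
  "'y measure \<Rightarrow> ('y \<Rightarrow> 'y \<Rightarrow> real) \<Rightarrow> 'y \<Rightarrow> 'y \<Rightarrow> real \<Rightarrow> real \<Rightarrow> real \<Rightarrow> ereal" where
  "\<psi> MY l h1 h2 q_plus q_minus \<alpha> =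
     \<phi> MY l h1 h2 (\<alpha> * q_plus + (1 - \<alpha>) * q_minus)
     - ereal \<alpha> * \<phi> MY l h1 h2 q_plus - ereal (1 - \<alpha>) * \<phi> MY l h1 h2 q_minus"

definition edge_discrepancy_I ::
  "'y measure \<Rightarrow> ('y \<Rightarrow> 'y \<Rightarrow> real) \<Rightarrow> 'y \<Rightarrow> 'y \<Rightarrow> real \<Rightarrow> real \<Rightarrow> ereal" where
  "edge_discrepancy_I MY l h1 h2 p_plus p_minus = \<psi> MY l h1 h2 p_plus p_minus (1 / 2)"

definition edge_discrepancy_II :: "real \<Rightarrow> real \<Rightarrow> real" where
  "edge_discrepancy_II p_plus p_minus =
     (sqrt (p_plus * (1 - p_minus)) - sqrt ((1 - p_plus) * p_minus))\<^sup>2"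

end

theory Submission
  imports Defs
begin

text \<open>
  Averaging the excess risk over the sign vectors (Assouad's method) reduces the theorem to pairs
  of distributions that differ on a single cell \<open>XX j\<close>. On that cell the pointwise excess losses for
  \<open>p_plus\<close> and \<open>p_minus\<close> add up to at least \<open>2 * d_I\<close>, so each pair contributes at least
  \<open>2 * w * d_I\<close> times the overlap (one minus the total variation distance) of the two laws of the
  training set. Given the number \<open>N\<close> of training inputs in the cell, the overlap is at least
  \<open>1 - sqrt (1 - (1 - d_II) ^ N)\<close> by the Cauchy-Schwarz inequality; as \<open>N\<close> is binomial,
  concavity of the square root yields the lower bound \<open>1 - sqrt (1 - (1 - w * d_II) ^ n)\<close>, which
  dominates both bounds of the first assertion, also when \<open>n * w < 1\<close>. The event \<open>N = 0\<close> alone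
  gives the bound \<open>(1 - w) ^ n\<close>.

  Infinite values are harmless: with the convention \<open>\<infinity> - \<infinity> = \<infinity>\<close> the regret is \<open>\<infinity>\<close> as soon as
  one of its terms is infinite, and \<open>d_I = \<infinity>\<close> forces an infinite minimal risk when \<open>w > 0\<close>.
\<close>

subsection \<open>Conditional distributions\<close>

text \<open>The hypothesis on \<open>K\<close> concerns rectangles only. Drawing \<open>x\<close>
  from the first marginal and then \<open>y\<close> from \<open>K x\<close> defines a measure whose
  integrals are iterated by construction, so it suffices to identify it with
  \<open>P\<close>.\<close>

lemma nn_integral_conditional_distribution:
  assumes P: "prob_space P" "sets P = sets (MX \<Otimes>\<^sub>M MY)"
    and K: "conditional_distribution MX MY P K"
    and f: "f \<in> borel_measurable (MX \<Otimes>\<^sub>M MY)"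
  shows "(\<integral>\<^sup>+z. f z \<partial>P) = (\<integral>\<^sup>+x. \<integral>\<^sup>+y. f (x, y) \<partial>K x \<partial>distr P MX fst)"
proof -
  interpret P: prob_space P by fact
  define \<mu> where "\<mu> = distr P MX fst"
  have fst: "fst \<in> P \<rightarrow>\<^sub>M MX"
    using measurable_fst[of MX MY] by (simp add: measurable_cong_sets[OF P(2) refl])
  interpret \<mu>: prob_space \<mu>
    unfolding \<mu>_def using fst by (rule P.prob_space_distr)
  have sets_\<mu>: "sets \<mu> = sets MX" and space_\<mu>: "space \<mu> = space MX"
    by (simp_all add: \<mu>_def)
  have K_prob: "K \<in> MX \<rightarrow>\<^sub>M prob_algebra MY"
    using K by (simp add: conditional_distribution_def)
  then have K_sub: "K \<in> MX \<rightarrow>\<^sub>M subprob_algebra MY"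
    by (rule measurable_prob_algebraD)
  have K_sets: "sets (K x) = sets MY" if "x \<in> space MX" for x
    using K_sub that by (rule sets_kernel)
  define N where
    "N = \<mu> \<bind> (\<lambda>x. K x \<bind> (\<lambda>y. return (MX \<Otimes>\<^sub>M MY) (x, y)))"
  have K_\<mu>: "K \<in> \<mu> \<rightarrow>\<^sub>M subprob_algebra MY"
    using K_sub by (simp add: measurable_cong_sets[OF sets_\<mu> refl])
  have pair: "(\<lambda>z. (fst z, snd z)) \<in> \<mu> \<Otimes>\<^sub>M MY \<rightarrow>\<^sub>M MX \<Otimes>\<^sub>M MY"
    by (simp add: measurable_cong_sets[OF sets_pair_measure_cong[OF sets_\<mu> refl] refl])
  have kernel:
    "(\<lambda>x. K x \<bind> (\<lambda>y. return (MX \<Otimes>\<^sub>M MY) (x, y))) \<in> \<mu> \<rightarrow>\<^sub>M subprob_algebra (MX \<Otimes>\<^sub>M MY)"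
    by (rule measurable_bind[OF K_\<mu> measurable_compose[OF pair return_measurable]])
  have return:
    "(\<lambda>y. return (MX \<Otimes>\<^sub>M MY) (x, y)) \<in> K x \<rightarrow>\<^sub>M subprob_algebra (MX \<Otimes>\<^sub>M MY)"
    if "x \<in> space MX" for x
    unfolding measurable_cong_sets[OF K_sets[OF that] refl]
    by (rule measurable_compose[OF measurable_Pair1'[OF that] return_measurable])
  have N_sets: "sets N = sets (MX \<Otimes>\<^sub>M MY)"
    unfolding N_def by (rule sets_bind_measurable[OF kernel \<mu>.not_empty])
  have nn_N: "(\<integral>\<^sup>+z. g z \<partial>N) = (\<integral>\<^sup>+x. \<integral>\<^sup>+y. g (x, y) \<partial>K x \<partial>\<mu>)"
    if g: "g \<in> borel_measurable (MX \<Otimes>\<^sub>M MY)" for g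
  proof -
    have "(\<integral>\<^sup>+z. g z \<partial>N) = (\<integral>\<^sup>+x. \<integral>\<^sup>+z. g z \<partial>(K x \<bind> (\<lambda>y. return (MX \<Otimes>\<^sub>M MY) (x, y))) \<partial>\<mu>)"
      unfolding N_def by (rule nn_integral_bind[OF g kernel])
    also have "\<dots> = (\<integral>\<^sup>+x. \<integral>\<^sup>+y. g (x, y) \<partial>K x \<partial>\<mu>)"
    proof (rule nn_integral_cong)
      fix x assume "x \<in> space \<mu>"
      then have x: "x \<in> space MX" by (simp add: space_\<mu>)
      have "(\<integral>\<^sup>+z. g z \<partial>(K x \<bind> (\<lambda>y. return (MX \<Otimes>\<^sub>M MY) (x, y))))
          = (\<integral>\<^sup>+y. \<integral>\<^sup>+z. g z \<partial>return (MX \<Otimes>\<^sub>M MY) (x, y) \<partial>K x)"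
        by (rule nn_integral_bind[OF g return[OF x]])
      also have "\<dots> = (\<integral>\<^sup>+y. g (x, y) \<partial>K x)"
        using x by (intro nn_integral_cong nn_integral_return g)
          (auto simp: space_pair_measure sets_eq_imp_space_eq[OF K_sets[OF x]])
      finally show "(\<integral>\<^sup>+z. g z \<partial>(K x \<bind> (\<lambda>y. return (MX \<Otimes>\<^sub>M MY) (x, y))))
          = (\<integral>\<^sup>+y. g (x, y) \<partial>K x)" .
    qed
    finally show ?thesis .
  qed
  \<comment> \<open>Rectangles are stable under intersection and generate the product
    \<sigma>-algebra. The whole space is itself a rectangle of finite mass, so a constant sequence
    serves as the exhaustion.\<close>
  have "P = N"
  proof (rule measure_eqI_generator_eq[OF Int_stable_pair_measure_generator[of MX MY],
        where \<Omega> = "space MX \<times> space MY" and A = "\<lambda>_. space MX \<times> space MY"])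
    show "{a \<times> b |a b. a \<in> sets MX \<and> b \<in> sets MY} \<subseteq> Pow (space MX \<times> space MY)"
      using sets.space_closed[of MX] sets.space_closed[of MY] by auto
    show "sets P = sigma_sets (space MX \<times> space MY) {a \<times> b |a b. a \<in> sets MX \<and> b \<in> sets MY}"
      by (simp add: P(2) sets_pair_measure)
    show "sets N = sigma_sets (space MX \<times> space MY) {a \<times> b |a b. a \<in> sets MX \<and> b \<in> sets MY}"
      by (simp add: N_sets sets_pair_measure)
    fix X assume "X \<in> {a \<times> b |a b. a \<in> sets MX \<and> b \<in> sets MY}"
    then obtain A B where X: "X = A \<times> B" and A: "A \<in> sets MX" and B: "B \<in> sets MY"
      by auto
    have "emeasure N X = (\<integral>\<^sup>+z. indicator X z \<partial>N)"
      using A B by (simp add: X N_sets)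
    also have "\<dots> = (\<integral>\<^sup>+x. \<integral>\<^sup>+y. indicator X (x, y) \<partial>K x \<partial>\<mu>)"
      unfolding X using A B by (intro nn_N borel_measurable_indicator pair_measureI)
    also have "\<dots> = (\<integral>\<^sup>+x. emeasure (K x) B * indicator A x \<partial>\<mu>)"
    proof (rule nn_integral_cong)
      fix x assume "x \<in> space \<mu>"
      then have x: "x \<in> space MX" by (simp add: space_\<mu>)
      have "(\<integral>\<^sup>+y. indicator X (x, y) \<partial>K x) = (\<integral>\<^sup>+y. indicator A x * indicator B y \<partial>K x)"
        by (simp add: X indicator_times)
      also have "\<dots> = emeasure (K x) B * indicator A x"
        using B by (simp add: nn_integral_cmult_indicator K_sets[OF x] mult.commute)
      finally show "(\<integral>\<^sup>+y. indicator X (x, y) \<partial>K x) = emeasure (K x) B * indicator A x" .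
    qed
    also have "\<dots> = emeasure P X"
      using K A B by (simp add: conditional_distribution_def X \<mu>_def)
    finally show "emeasure P X = emeasure N X" ..
  qed (auto)
  then show ?thesis
    using nn_N[OF f] by (simp add: \<mu>_def)
qed

text \<open>The two atoms carry total mass 1, so \<open>f\<close> agrees almost everywhere with a
  combination of two indicators.\<close>

lemma nn_integral_two_atoms:
  assumes M: "prob_space M" and f: "f \<in> borel_measurable M"
    and atoms: "{a} \<in> sets M" "{b} \<in> sets M" "a \<noteq> b"
    and p: "measure M {a} = p" "measure M {b} = 1 - p"
  shows "(\<integral>\<^sup>+y. f y \<partial>M) = ennreal p * f a + ennreal (1 - p) * f b"
proof -
  interpret prob_space M by fact
  have "prob ({a} \<union> {b}) = 1"
    using atoms p by (subst finite_measure_Union) simp_all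
  moreover have "{a} \<union> {b} \<in> events"
    using atoms(1,2) by (rule sets.Un)
  ultimately have "AE y in M. y \<in> {a} \<union> {b}"
    by (simp only: prob_eq_1)
  then have "(\<integral>\<^sup>+y. f y \<partial>M) = (\<integral>\<^sup>+y. f a * indicator {a} y + f b * indicator {b} y \<partial>M)"
    using atoms(3) by (intro nn_integral_cong_AE) (auto split: split_indicator elim!: AE_mp)
  also have "\<dots> = f a * emeasure M {a} + f b * emeasure M {b}"
    using atoms by (simp add: nn_integral_add nn_integral_cmult_indicator)
  finally show ?thesis
    using p by (simp add: emeasure_eq_measure mult.commute)
qed

subsection \<open>Overlap of two product distributions\<close>

text \<open>
  For \<open>u = v = 1\<close> this is one minus the total variation distance between the \<open>n\<close>-fold products of
  the distributions on three points with weights \<open>(1 - w, w * p, w * (1 - p))\<close> and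
  \<open>(1 - w, w * q, w * (1 - q))\<close>; \<open>u\<close> and \<open>v\<close> are the likelihoods accumulated so far.
\<close>

fun overlap :: "real \<Rightarrow> real \<Rightarrow> real \<Rightarrow> nat \<Rightarrow> real \<Rightarrow> real \<Rightarrow> real" where
  "overlap w p q 0 u v = min u v"
| "overlap w p q (Suc n) u v = (1 - w) * overlap w p q n u v
     + w * (overlap w p q n (p * u) (q * v) + overlap w p q n ((1 - p) * u) ((1 - q) * v))"

lemma overlap_nonneg:
  "\<lbrakk>0 \<le> w; w \<le> 1; 0 \<le> p; p \<le> 1; 0 \<le> q; q \<le> 1; 0 \<le> u; 0 \<le> v\<rbrakk> \<Longrightarrow> 0 \<le> overlap w p q n u v"
  by (induction n arbitrary: u v) (auto intro!: add_nonneg_nonneg mult_nonneg_nonneg)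

text \<open>Only the first summand of the recursion is kept at each step, which corresponds to no
  observation falling into the cell.\<close>

lemma overlap_ge_power:
  assumes "0 \<le> w" "w \<le> 1" "0 \<le> p" "p \<le> 1" "0 \<le> q" "q \<le> 1" "0 \<le> u" "0 \<le> v"
  shows "(1 - w) ^ n * min u v \<le> overlap w p q n u v"
  using assms(7,8)
proof (induction n arbitrary: u v)
  case (Suc n)
  have "(1 - w) ^ Suc n * min u v \<le> (1 - w) * overlap w p q n u v"
    using mult_left_mono[OF Suc.IH[OF Suc.prems], of "1 - w"] assms by simp
  moreover have "0 \<le> w * (overlap w p q n (p * u) (q * v) + overlap w p q n ((1 - p) * u) ((1 - q) * v))"
    using assms Suc.prems by (intro mult_nonneg_nonneg add_nonneg_nonneg overlap_nonneg) auto
  ultimately show ?case by simp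
qed simp

section \<open>Square-root inequalities and the Hellinger affinity\<close>

text \<open>Reverse triangle inequality for the Lorentz norm
  \<open>sqrt (a\<^sup>2 - b\<^sup>2)\<close> on the forward cone. After squaring it becomes the
  reverse Cauchy-Schwarz inequality, whose defect is the square of
  \<open>a * d - b * c\<close>.\<close>

lemma sqrt_diff_squares_add_le:
  fixes a b c d :: real
  assumes "0 \<le> b" "b \<le> a" "0 \<le> d" "d \<le> c"
  shows "sqrt (a\<^sup>2 - b\<^sup>2) + sqrt (c\<^sup>2 - d\<^sup>2) \<le> sqrt ((a + c)\<^sup>2 - (b + d)\<^sup>2)"
proof -
  have D: "0 \<le> a\<^sup>2 - b\<^sup>2" "0 \<le> c\<^sup>2 - d\<^sup>2"
    using assms by (auto intro!: power_mono)
  have "(a\<^sup>2 - b\<^sup>2) * (c\<^sup>2 - d\<^sup>2) \<le> (a * c - b * d)\<^sup>2"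
  proof -
    have "(a * c - b * d)\<^sup>2 - (a\<^sup>2 - b\<^sup>2) * (c\<^sup>2 - d\<^sup>2) = (a * d - b * c)\<^sup>2"
      by algebra
    then show ?thesis by (metis diff_ge_0_iff_ge zero_le_power2)
  qed
  moreover have "0 \<le> a * c - b * d"
    using assms mult_mono[of b a d c] by simp
  ultimately have "sqrt (a\<^sup>2 - b\<^sup>2) * sqrt (c\<^sup>2 - d\<^sup>2) \<le> a * c - b * d"
    by (metis real_sqrt_mult real_le_lsqrt)
  then have "(sqrt (a\<^sup>2 - b\<^sup>2) + sqrt (c\<^sup>2 - d\<^sup>2))\<^sup>2 \<le> (a + c)\<^sup>2 - (b + d)\<^sup>2"
    using D by (simp add: power2_sum power2_diff algebra_simps)
  then show ?thesis
    by (rule real_le_rsqrt)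
qed

lemma sqrt_concave:
  fixes x y w :: real
  assumes "0 \<le> x" "0 \<le> y" "0 \<le> w" "w \<le> 1"
  shows "(1 - w) * sqrt x + w * sqrt y \<le> sqrt ((1 - w) * x + w * y)"
proof (rule real_le_rsqrt)
  have "(1 - w) * x + w * y - ((1 - w) * sqrt x + w * sqrt y)\<^sup>2 = w * (1 - w) * (sqrt x - sqrt y)\<^sup>2"
  proof -
    have *: "x = (sqrt x)\<^sup>2" "y = (sqrt y)\<^sup>2" using assms by auto
    have "(1 - w) * s\<^sup>2 + w * t\<^sup>2 - ((1 - w) * s + w * t)\<^sup>2 = w * (1 - w) * (s - t)\<^sup>2" for s t :: real
      by algebra
    from this[of "sqrt x" "sqrt y"] show ?thesis using * by simp
  qed
  moreover have "0 \<le> w * (1 - w) * (sqrt x - sqrt y)\<^sup>2"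
    using assms by auto
  ultimately show "((1 - w) * sqrt x + w * sqrt y)\<^sup>2 \<le> (1 - w) * x + w * y"
    by linarith
qed

text \<open>The base on the right is the Hellinger affinity of the Bernoulli laws with parameters
  \<open>p\<close> and \<open>q\<close>. In this form the discrepancy enters the recursion for the
  overlap.\<close>

lemma edge_discrepancy_II_eq:
  assumes "0 \<le> p" "p \<le> 1" "0 \<le> q" "q \<le> 1"
  shows "1 - edge_discrepancy_II p q = (sqrt (p * q) + sqrt ((1 - p) * (1 - q)))\<^sup>2"
proof -
  have "(sqrt (p * (1 - q)) - sqrt ((1 - p) * q))\<^sup>2
      = p * (1 - q) + (1 - p) * q - 2 * (sqrt p * sqrt (1 - q) * (sqrt (1 - p) * sqrt q))"
    using assms by (simp add: power2_diff real_sqrt_mult power_mult_distrib)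
  moreover have "(sqrt (p * q) + sqrt ((1 - p) * (1 - q)))\<^sup>2
      = p * q + (1 - p) * (1 - q) + 2 * (sqrt p * sqrt q * (sqrt (1 - p) * sqrt (1 - q)))"
    using assms by (simp add: power2_sum real_sqrt_mult power_mult_distrib)
  ultimately show ?thesis
    by (simp add: edge_discrepancy_II_def algebra_simps)
qed

lemma edge_discrepancy_II_bounds:
  assumes "0 \<le> p" "p \<le> 1" "0 \<le> q" "q \<le> 1"
  shows "0 \<le> edge_discrepancy_II p q" "edge_discrepancy_II p q \<le> 1"
proof -
  show "0 \<le> edge_discrepancy_II p q" by (simp add: edge_discrepancy_II_def)
  have "0 \<le> 1 - edge_discrepancy_II p q"
    unfolding edge_discrepancy_II_eq[OF assms] by simp
  then show "edge_discrepancy_II p q \<le> 1" by simp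
qed

text \<open>
  The recursion preserves this form: the two labels are merged by the reverse triangle inequality of
  the Lorentz form, the cell and its complement by the concavity of the square root.
\<close>

lemma overlap_ge_sqrt:
  fixes p q w :: real
  defines "d \<equiv> edge_discrepancy_II p q"
  assumes w: "0 \<le> w" "w \<le> 1" and pq: "0 \<le> p" "p \<le> 1" "0 \<le> q" "q \<le> 1" and uv: "0 \<le> u" "0 \<le> v"
  shows "(u + v) / 2 - sqrt ((u + v)\<^sup>2 - 4 * (1 - w * d) ^ n * (u * v)) / 2 \<le> overlap w p q n u v"
  using uv
proof (induction n arbitrary: u v)
  case 0
  have "(u + v)\<^sup>2 - 4 * (u * v) = (u - v)\<^sup>2"
    by algebra
  then show ?case
    by (simp add: min_def field_simps)
next
  case (Suc n)
  have d: "0 \<le> d" "d \<le> 1"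
    unfolding d_def by (rule edge_discrepancy_II_bounds[OF pq])+
  define r where "r = (1 - w * d) ^ n"
  have wd: "w * d \<le> 1"
    using w d by (simp add: mult_le_one)
  then have r: "0 \<le> r" "r \<le> 1"
    using w d by (auto simp: r_def intro!: power_le_one)
  \<comment> \<open>This is the discriminant of \<open>t\<^sup>2 - (u + v) * t + r * u * v\<close>.
    The claimed lower bound is the smaller root, which equals \<open>min u v\<close> at
    \<open>r = 1\<close>.\<close>
  define D where "D = (\<lambda>u v r :: real. (u + v)\<^sup>2 - 4 * r * (u * v))"
  have D_nonneg: "0 \<le> D u v r'" if "0 \<le> u" "0 \<le> v" "r' \<le> 1" for u v r'
  proof -
    have "D u v r' = (u - v)\<^sup>2 + 4 * (1 - r') * (u * v)"
      unfolding D_def by algebra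
    then show ?thesis using that by simp
  qed
  \<comment> \<open>The squares of \<open>b1\<close> and \<open>b2\<close> are the terms subtracted
    in \<open>D\<close> for the two labels, so both discriminants become differences of squares as
    the Lorentz inequality requires.\<close>
  define b1 where "b1 = 2 * sqrt r * sqrt ((p * u) * (q * v))"
  define b2 where "b2 = 2 * sqrt r * sqrt (((1 - p) * u) * ((1 - q) * v))"
  have b_le: "2 * sqrt r * sqrt (s * t) \<le> s + t" if "0 \<le> s" "0 \<le> t" for s t
  proof -
    have "sqrt r * sqrt (s * t) \<le> 1 * ((s + t) / 2)"
      using r that arith_geo_mean_sqrt[OF that] by (intro mult_mono) auto
    then show ?thesis by simp
  qed
  have sum: "(p * u + q * v) + ((1 - p) * u + (1 - q) * v) = u + v"
    by algebra
  \<comment> \<open>Adding before squaring produces the Hellinger affinity, whose square is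
    \<open>1 - d\<close>; observing a label in the cell thus turns \<open>r\<close> into
    \<open>r * (1 - d)\<close>.\<close>
  have "(b1 + b2)\<^sup>2 = 4 * r * (u * v) * (sqrt (p * q) + sqrt ((1 - p) * (1 - q)))\<^sup>2"
  proof -
    have "b1 + b2 = 2 * sqrt r * sqrt (u * v) * (sqrt (p * q) + sqrt ((1 - p) * (1 - q)))"
      unfolding b1_def b2_def real_sqrt_mult by algebra
    then show ?thesis
      using r uv Suc.prems by (simp add: power_mult_distrib)
  qed
  then have b_sum: "(b1 + b2)\<^sup>2 = 4 * (r * (1 - d)) * (u * v)"
    using edge_discrepancy_II_eq[OF pq] by (simp add: d_def)
  have "sqrt (D (p * u) (q * v) r) + sqrt (D ((1 - p) * u) ((1 - q) * v) r)
      = sqrt ((p * u + q * v)\<^sup>2 - b1\<^sup>2) + sqrt (((1 - p) * u + (1 - q) * v)\<^sup>2 - b2\<^sup>2)"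
    using r pq Suc.prems by (simp add: D_def b1_def b2_def power_mult_distrib)
  also have "\<dots> \<le> sqrt ((u + v)\<^sup>2 - (b1 + b2)\<^sup>2)"
    unfolding sum[symmetric]
    using pq r Suc.prems by (intro sqrt_diff_squares_add_le) (auto simp: b1_def b2_def intro!: b_le)
  finally have split: "sqrt (D (p * u) (q * v) r) + sqrt (D ((1 - p) * u) ((1 - q) * v) r)
      \<le> sqrt (D u v (r * (1 - d)))"
    by (simp add: b_sum D_def)
  have rd: "r * (1 - d) \<le> 1"
    using r d by (simp add: mult_le_one)
  have "(1 - w) * sqrt (D u v r)
      + w * (sqrt (D (p * u) (q * v) r) + sqrt (D ((1 - p) * u) ((1 - q) * v) r))
    \<le> (1 - w) * sqrt (D u v r) + w * sqrt (D u v (r * (1 - d)))"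
    using split w by (intro add_left_mono mult_left_mono)
  also have "\<dots> \<le> sqrt ((1 - w) * D u v r + w * D u v (r * (1 - d)))"
    using Suc.prems r rd w by (intro sqrt_concave D_nonneg)
  \<comment> \<open>\<open>D\<close> is affine in its last argument, so the values \<open>r\<close>
    and \<open>r * (1 - d)\<close> average to \<open>r * (1 - w * d)\<close>.\<close>
  also have "(1 - w) * D u v r + w * D u v (r * (1 - d)) = D u v (r * (1 - w * d))"
    unfolding D_def by algebra
  finally have D_le: "(1 - w) * sqrt (D u v r)
      + w * (sqrt (D (p * u) (q * v) r) + sqrt (D ((1 - p) * u) ((1 - q) * v) r))
      \<le> sqrt (D u v (r * (1 - w * d)))" .
  have IH: "(u + v) / 2 - sqrt (D u v r) / 2 \<le> overlap w p q n u v" if "0 \<le> u" "0 \<le> v" for u v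
    using Suc.IH[OF that] by (simp add: D_def r_def)
  have "(u + v) / 2 - sqrt (D u v (r * (1 - w * d))) / 2
    \<le> (1 - w) * ((u + v) / 2 - sqrt (D u v r) / 2)
      + w * (((p * u + q * v) / 2 - sqrt (D (p * u) (q * v) r) / 2)
          + (((1 - p) * u + (1 - q) * v) / 2 - sqrt (D ((1 - p) * u) ((1 - q) * v) r) / 2))"
    using D_le by (simp add: field_simps)
  also have "\<dots> \<le> overlap w p q (Suc n) u v"
    unfolding overlap.simps using w pq Suc.prems
    by (intro add_mono mult_left_mono IH) auto
  finally show ?case
    by (simp add: D_def r_def mult.commute)
qed

section \<open>Real powers and the resulting bounds on the overlap\<close>

text \<open>Weighted arithmetic-geometric mean inequality for the numbers \<open>1 - d\<close> and 1
  with weights \<open>w\<close> and \<open>1 - w\<close>. At \<open>d = 1\<close> the left side is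
  0.\<close>

lemma powr_le_one_minus_mult:
  fixes d w :: real
  assumes "0 \<le> d" "d \<le> 1" "0 < w" "w \<le> 1"
  shows "(1 - d) powr w \<le> 1 - w * d"
proof (cases "d = 1")
  case False
  then have "(1 - d) powr w * 1 powr (1 - w) \<le> w * (1 - d) + (1 - w) * 1"
    using assms by (intro Youngs_inequality_0) auto
  then show ?thesis by (simp add: algebra_simps)
qed (use assms in auto)

text \<open>Bernoulli inequality with a real exponent: where the left side is positive, the
  preceding inequality is applied to \<open>a * d\<close> with weight \<open>1 / a\<close> and then
  raised to the power \<open>a\<close>.\<close>

lemma one_minus_mult_le_powr:
  fixes d a :: real
  assumes "0 \<le> d" "d \<le> 1" "1 \<le> a"
  shows "1 - a * d \<le> (1 - d) powr a"
proof (cases "0 < 1 - a * d")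
  case True
  have "(1 - (a * d)) powr (1 / a) \<le> 1 - 1 / a * (a * d)"
    using assms True by (intro powr_le_one_minus_mult) auto
  then have "((1 - (a * d)) powr (1 / a)) powr a \<le> (1 - d) powr a"
    using assms by (intro powr_mono2) auto
  then show ?thesis using True assms by (simp add: powr_powr)
qed (use powr_ge_zero[of "1 - d" a] in linarith)

text \<open>Both bounds weaken \<open>1 - sqrt (1 - (1 - w * d) ^ n)\<close>, which is
  \<open>overlap_ge_sqrt\<close> at \<open>u = v = 1\<close>: the first by
  \<open>(1 - d) powr w \<le> 1 - w * d\<close>, the second by the Bernoulli inequality with integer
  exponent. The second does not pass through the first and so covers \<open>n * w < 1\<close> as
  well.\<close>

lemma one_minus_le_overlap:
  fixes p q w :: real
  defines "d \<equiv> edge_discrepancy_II p q"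
  assumes w: "0 < w" "w \<le> 1" and pq: "0 \<le> p" "p \<le> 1" "0 \<le> q" "q \<le> 1"
    and n: "1 \<le> n"
  shows "1 - sqrt (1 - (1 - d) powr (n * w)) \<le> overlap w p q n 1 1"
    and "1 - sqrt (n * w * d) \<le> overlap w p q n 1 1"
proof -
  have d: "0 \<le> d" "d \<le> 1"
    unfolding d_def by (rule edge_discrepancy_II_bounds[OF pq])+
  have wd: "w * d \<le> 1"
    using w d by (simp add: mult_le_one)
  have "sqrt ((1 + 1)\<^sup>2 - 4 * (1 - w * d) ^ n * (1 * 1)) = 2 * sqrt (1 - (1 - w * d) ^ n)"
    using real_sqrt_mult[of 4 "1 - (1 - w * d) ^ n"] by (simp add: algebra_simps)
  then have *: "1 - sqrt (1 - (1 - w * d) ^ n) \<le> overlap w p q n 1 1"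
    using overlap_ge_sqrt[of w p q 1 1 n] w pq by (simp add: d_def)
  \<comment> \<open>At \<open>d = 1\<close> the base is 0. Real powers of 0 are 0 by convention,
    whereas \<open>0 ^ n\<close> vanishes because \<open>n\<close> is positive.\<close>
  have "(1 - d) powr (n * w) = ((1 - d) powr w) ^ n"
    using d by (cases "d = 1") (use w n in \<open>auto simp: powr_powr powr_realpow[symmetric] mult.commute powr_def exp_of_nat_mult[symmetric] zero_power\<close>)
  also have "\<dots> \<le> (1 - w * d) ^ n"
    using powr_le_one_minus_mult[OF d w] by (intro power_mono) auto
  finally show "1 - sqrt (1 - (1 - d) powr (n * w)) \<le> overlap w p q n 1 1"
    using * by (smt (verit) real_sqrt_le_iff)
  have "1 + real n * - (w * d) \<le> (1 + - (w * d)) ^ n"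
    using wd by (intro Bernoulli_inequality) auto
  then show "1 - sqrt (n * w * d) \<le> overlap w p q n 1 1"
    using * by (smt (verit) real_sqrt_le_iff mult.assoc mult_minus_right)
qed

text \<open>
  Induction on \<open>n\<close>, splitting off one observation, makes densities of the product measures unnecessary.
\<close>

lemma overlap_le_nn_integral_PiM:
  fixes w p q :: real
  assumes P: "prob_space P" "sets P = sets N" and Q: "prob_space Q" "sets Q = sets N"
    and \<kappa>: "sets \<kappa>0 = sets N" "sets \<kappa>1 = sets N" "sets \<kappa>2 = sets N"
    and mass: "emeasure \<kappa>0 (space N) = ennreal (1 - w)" "emeasure \<kappa>1 (space N) = ennreal w"
      "emeasure \<kappa>2 (space N) = ennreal w"
    and P_eq: "\<And>f. f \<in> borel_measurable N \<Longrightarrow> (\<integral>\<^sup>+z. f z \<partial>P)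
      = (\<integral>\<^sup>+z. f z \<partial>\<kappa>0) + (ennreal p * (\<integral>\<^sup>+z. f z \<partial>\<kappa>1) + ennreal (1 - p) * (\<integral>\<^sup>+z. f z \<partial>\<kappa>2))"
    and Q_eq: "\<And>f. f \<in> borel_measurable N \<Longrightarrow> (\<integral>\<^sup>+z. f z \<partial>Q)
      = (\<integral>\<^sup>+z. f z \<partial>\<kappa>0) + (ennreal q * (\<integral>\<^sup>+z. f z \<partial>\<kappa>1) + ennreal (1 - q) * (\<integral>\<^sup>+z. f z \<partial>\<kappa>2))"
    and w: "0 \<le> w" "w \<le> 1" and pq: "0 \<le> p" "p \<le> 1" "0 \<le> q" "q \<le> 1"
    and uv: "0 \<le> u" "0 \<le> v"
    and AB: "A \<in> borel_measurable (PiM {..<n} (\<lambda>_. N))" "B \<in> borel_measurable (PiM {..<n} (\<lambda>_. N))"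
    and c: "\<And>z. z \<in> space (PiM {..<n} (\<lambda>_. N)) \<Longrightarrow> c \<le> A z + B z"
  shows "c * ennreal (overlap w p q n u v)
    \<le> ennreal u * (\<integral>\<^sup>+z. A z \<partial>PiM {..<n} (\<lambda>_. P)) + ennreal v * (\<integral>\<^sup>+z. B z \<partial>PiM {..<n} (\<lambda>_. Q))"
  using uv AB c
proof (induction n arbitrary: u v A B)
  case 0
  \<comment> \<open>The product over no coordinates is the point mass at the everywhere undefined
    function.\<close>
  have "c * ennreal (min u v) \<le> (A (\<lambda>_. undefined) + B (\<lambda>_. undefined)) * ennreal (min u v)"
    using 0(5)[of "\<lambda>_. undefined"] by (intro mult_right_mono) (auto simp: space_PiM)
  also have "\<dots> \<le> A (\<lambda>_. undefined) * ennreal u + B (\<lambda>_. undefined) * ennreal v"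
    unfolding distrib_right by (intro add_mono mult_left_mono ennreal_leI) auto
  finally show ?case
    by (simp add: PiM_empty nn_integral_count_space_finite mult.commute)
next
  case (Suc n)
  interpret P: prob_space P by fact
  interpret Q: prob_space Q by fact
  interpret PP: product_prob_space "\<lambda>_ :: nat. P" "{..<n}" by standard
  interpret QQ: product_prob_space "\<lambda>_ :: nat. Q" "{..<n}" by standard
  have sets_PP: "sets (PiM I (\<lambda>_. P)) = sets (PiM I (\<lambda>_. N))"
    and sets_QQ: "sets (PiM I (\<lambda>_. Q)) = sets (PiM I (\<lambda>_. N))" for I :: "nat set"
    by (rule sets_PiM_cong[OF refl P(2)]) (rule sets_PiM_cong[OF refl Q(2)])
  have ins: "{..<Suc n} = insert n {..<n}" by auto
  have "(\<lambda>x. (\<lambda>(z, x). z(n := x)) ((\<lambda>(x, z). (z, x)) x)) \<in> N \<Otimes>\<^sub>M PiM {..<n} (\<lambda>_. N) \<rightarrow>\<^sub>M PiM {..<Suc n} (\<lambda>_. N)"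
    unfolding ins by (rule measurable_compose[OF measurable_pair_swap' measurable_add_dim])
  then have upd: "(\<lambda>(x, z). z(n := x)) \<in> N \<Otimes>\<^sub>M PiM {..<n} (\<lambda>_. N) \<rightarrow>\<^sub>M PiM {..<Suc n} (\<lambda>_. N)"
    by (simp add: split_def)
  have upd_const: "(\<lambda>z. z(n := x)) \<in> PiM {..<n} (\<lambda>_. N) \<rightarrow>\<^sub>M PiM {..<Suc n} (\<lambda>_. N)" if "x \<in> space N" for x
    using measurable_compose[OF measurable_Pair1'[OF that] upd] by simp
  \<comment> \<open>These are the integrals over the first \<open>n\<close> observations with the
    last one fixed to \<open>x\<close>. The hypothesis on \<open>c\<close> survives fixing a
    coordinate, so the induction hypothesis applies for each \<open>x\<close>.\<close>
  define a where "a x = (\<integral>\<^sup>+z. A (z(n := x)) \<partial>PiM {..<n} (\<lambda>_. P))" for x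
  define b where "b x = (\<integral>\<^sup>+z. B (z(n := x)) \<partial>PiM {..<n} (\<lambda>_. Q))" for x
  have a_meas: "a \<in> borel_measurable N"
    unfolding a_def using measurable_compose[OF upd Suc.prems(3)]
    by (intro PP.P.borel_measurable_nn_integral)
       (simp add: measurable_cong_sets[OF sets_pair_measure_cong[OF refl sets_PP] refl] split_def del: fun_upd_apply)
  have b_meas: "b \<in> borel_measurable N"
    unfolding b_def using measurable_compose[OF upd Suc.prems(4)]
    by (intro QQ.P.borel_measurable_nn_integral)
       (simp add: measurable_cong_sets[OF sets_pair_measure_cong[OF refl sets_QQ] refl] split_def del: fun_upd_apply)
  have A_int: "(\<integral>\<^sup>+z. A z \<partial>PiM {..<Suc n} (\<lambda>_. P)) = (\<integral>\<^sup>+x. a x \<partial>P)"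
    unfolding a_def ins using Suc.prems(3)
    by (intro PP.product_nn_integral_insert_rev)
       (simp_all add: measurable_cong_sets[OF sets_PP refl] flip: ins)
  have B_int: "(\<integral>\<^sup>+z. B z \<partial>PiM {..<Suc n} (\<lambda>_. Q)) = (\<integral>\<^sup>+x. b x \<partial>Q)"
    unfolding b_def ins using Suc.prems(4)
    by (intro QQ.product_nn_integral_insert_rev)
       (simp_all add: measurable_cong_sets[OF sets_QQ refl] flip: ins)
  have IH: "c * ennreal (overlap w p q n s t) \<le> ennreal s * a x + ennreal t * b x"
    if "0 \<le> s" "0 \<le> t" "x \<in> space N" for s t x
    unfolding a_def b_def
  proof (rule Suc.IH[OF that(1,2)])
    fix z assume "z \<in> space (PiM {..<n} (\<lambda>_. N))"
    then show "c \<le> A (z(n := x)) + B (z(n := x))"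
      using measurable_space[OF upd_const[OF that(3)]] by (intro Suc.prems(5)) (simp del: fun_upd_apply)
  qed (use measurable_compose[OF upd_const[OF that(3)]] Suc.prems(3,4) in \<open>auto simp del: fun_upd_apply\<close>)
  \<comment> \<open>The induction hypothesis, integrated over the last observation against one piece
    of total mass \<open>m\<close>.\<close>
  have part: "c * ennreal (overlap w p q n s t) * ennreal m
      \<le> ennreal s * (\<integral>\<^sup>+x. a x \<partial>\<kappa>) + ennreal t * (\<integral>\<^sup>+x. b x \<partial>\<kappa>)"
    if st: "0 \<le> s" "0 \<le> t" and \<kappa>: "sets \<kappa> = sets N" "emeasure \<kappa> (space N) = ennreal m"
    for s t \<kappa> m
  proof -
    have ab: "a \<in> borel_measurable \<kappa>" "b \<in> borel_measurable \<kappa>"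
      using a_meas b_meas by (simp_all add: measurable_cong_sets[OF \<kappa>(1) refl])
    have space: "space \<kappa> = space N"
      using \<kappa>(1) by (rule sets_eq_imp_space_eq)
    have "c * ennreal (overlap w p q n s t) * ennreal m
        = (\<integral>\<^sup>+x. c * ennreal (overlap w p q n s t) \<partial>\<kappa>)"
      using \<kappa>(2) by (simp add: space)
    also have "\<dots> \<le> (\<integral>\<^sup>+x. ennreal s * a x + ennreal t * b x \<partial>\<kappa>)"
      using IH[OF st] by (intro nn_integral_mono) (simp add: space)
    finally show ?thesis
      using ab by (simp add: nn_integral_add nn_integral_cmult)
  qed
  define ov0 where "ov0 = overlap w p q n u v"
  define ov1 where "ov1 = overlap w p q n (p * u) (q * v)"
  define ov2 where "ov2 = overlap w p q n ((1 - p) * u) ((1 - q) * v)"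
  have ov: "0 \<le> ov0" "0 \<le> ov1" "0 \<le> ov2"
    unfolding ov0_def ov1_def ov2_def using w pq Suc.prems(1,2) by (auto intro!: overlap_nonneg)
  have mults: "ennreal (p * u) = ennreal p * ennreal u" "ennreal (q * v) = ennreal q * ennreal v"
    "ennreal ((1 - p) * u) = ennreal (1 - p) * ennreal u"
    "ennreal ((1 - q) * v) = ennreal (1 - q) * ennreal v"
    using Suc.prems(1,2) pq by (auto intro!: ennreal_mult)
  have "ennreal (overlap w p q (Suc n) u v)
      = ennreal ov0 * ennreal (1 - w) + (ennreal ov1 * ennreal w + ennreal ov2 * ennreal w)"
    unfolding overlap.simps ov0_def[symmetric] ov1_def[symmetric] ov2_def[symmetric]
    using ov w by (simp add: ennreal_mult distrib_left mult.commute)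
  then have "c * ennreal (overlap w p q (Suc n) u v)
      = c * ennreal ov0 * ennreal (1 - w) + (c * ennreal ov1 * ennreal w + c * ennreal ov2 * ennreal w)"
    by (simp add: algebra_simps)
  \<comment> \<open>The likelihoods are unchanged off the cell and multiplied by the label
    probabilities on it. This matches the recursion of \<open>overlap\<close> and, after regrouping,
    the decompositions of \<open>P\<close> and \<open>Q\<close>.\<close>
  also have "\<dots> \<le> (ennreal u * (\<integral>\<^sup>+x. a x \<partial>\<kappa>0) + ennreal v * (\<integral>\<^sup>+x. b x \<partial>\<kappa>0))
      + ((ennreal (p * u) * (\<integral>\<^sup>+x. a x \<partial>\<kappa>1) + ennreal (q * v) * (\<integral>\<^sup>+x. b x \<partial>\<kappa>1))
      + (ennreal ((1 - p) * u) * (\<integral>\<^sup>+x. a x \<partial>\<kappa>2) + ennreal ((1 - q) * v) * (\<integral>\<^sup>+x. b x \<partial>\<kappa>2)))"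
    unfolding ov0_def ov1_def ov2_def using Suc.prems(1,2) pq \<kappa> mass
    by (intro add_mono part) auto
  also have "\<dots> = ennreal u * (\<integral>\<^sup>+x. a x \<partial>P) + ennreal v * (\<integral>\<^sup>+x. b x \<partial>Q)"
    unfolding P_eq[OF a_meas] Q_eq[OF b_meas]
    unfolding mults by (simp add: distrib_left mult.assoc mult.left_commute add.assoc add.left_commute)
  finally show ?case
    by (simp only: A_int B_int)
qed

subsection \<open>Expectations and risks\<close>

text \<open>Monotonicity for an expectation that need not exist: the lower bound is a real constant
  of either sign plus a nonnegative function, so neither side involves an undefined
  difference.\<close>

lemma extended_expectation_ge:
  fixes f :: "'a \<Rightarrow> ereal" and c :: real
  assumes M: "prob_space M" and f: "f \<in> borel_measurable M" and h: "h \<in> borel_measurable M"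
    and le: "\<And>x. x \<in> space M \<Longrightarrow> ereal c + enn2ereal (h x) \<le> f x"
  shows "ereal c + enn2ereal (\<integral>\<^sup>+x. h x \<partial>M) \<le> extended_expectation M f"
proof -
  interpret prob_space M by fact
  \<comment> \<open>Every negative part is moved across, so the inequality can be integrated without
    subtraction. Since \<open>ennreal\<close> truncates at 0, \<open>ennreal c\<close> and
    \<open>ennreal (- c)\<close> are the two parts of \<open>c\<close>.\<close>
  have "h x + ennreal c + e2ennreal (- f x) \<le> e2ennreal (f x) + ennreal (- c)" if "x \<in> space M" for x
  proof (cases "f x")
    case (real r)
    then show ?thesis
    proof (cases "h x")
      case (real s)
      then have "c + s \<le> r"
        using le[OF that] \<open>f x = ereal r\<close> by (simp add: enn2ereal_ennreal)
      then show ?thesis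
        using real \<open>f x = ereal r\<close>
        by (cases "0 \<le> c"; cases "0 \<le> r")
          (auto simp: ennreal_neg ennreal_plus[symmetric] simp del: ennreal_plus intro!: ennreal_leI)
    qed (use le[OF that] in auto)
  qed (use le[OF that] in auto)
  then have "(\<integral>\<^sup>+x. h x + ennreal c + e2ennreal (- f x) \<partial>M) \<le> (\<integral>\<^sup>+x. e2ennreal (f x) + ennreal (- c) \<partial>M)"
    by (rule nn_integral_mono)
  then have *: "(\<integral>\<^sup>+x. h x \<partial>M) + ennreal c + (\<integral>\<^sup>+x. e2ennreal (- f x) \<partial>M)
      \<le> (\<integral>\<^sup>+x. e2ennreal (f x) \<partial>M) + ennreal (- c)"
    using f h by (simp add: nn_integral_add emeasure_space_1)
  \<comment> \<open>A finite integral of the positive part forces all the other integrals to be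
    finite. An infinite one makes the extended expectation infinite by convention.\<close>
  show ?thesis
  proof (cases "(\<integral>\<^sup>+x. e2ennreal (f x) \<partial>M)")
    case (real r)
    obtain s where s: "(\<integral>\<^sup>+x. h x \<partial>M) = ennreal s" "0 \<le> s"
      using * real by (cases "(\<integral>\<^sup>+x. h x \<partial>M)") (auto simp: top_unique ennreal_plus[symmetric] simp del: ennreal_plus)
    obtain t where t: "(\<integral>\<^sup>+x. e2ennreal (- f x) \<partial>M) = ennreal t" "0 \<le> t"
      using * real by (cases "(\<integral>\<^sup>+x. e2ennreal (- f x) \<partial>M)") (auto simp: top_unique ennreal_plus[symmetric] simp del: ennreal_plus)
    have "s + c + t \<le> r"
      using * real s t
      by (cases "0 \<le> c") (auto simp: ennreal_neg ennreal_plus[symmetric] simp del: ennreal_plus)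
    then show ?thesis
      using real s t by (simp add: extended_expectation_def enn2ereal_ennreal)
  qed (simp add: extended_expectation_def)
qed

lemma extended_expectation_real:
  assumes F: "integrable M F"
  shows "extended_expectation M (\<lambda>x. ereal (F x)) = ereal (\<integral>x. F x \<partial>M)"
proof -
  have "(\<integral>\<^sup>+x. ennreal (F x) \<partial>M) < \<infinity>" "(\<integral>\<^sup>+x. ennreal (- F x) \<partial>M) < \<infinity>"
    using F by (auto simp: real_integrable_def top.not_eq_extremum)
  then show ?thesis
    by (cases "\<integral>\<^sup>+x. ennreal (F x) \<partial>M"; cases "\<integral>\<^sup>+x. ennreal (- F x) \<partial>M")
      (auto simp: extended_expectation_def real_lebesgue_integral_def[OF F] enn2ereal_ennreal)
qed

text \<open>Because \<infinity> - \<infinity> counts as \<infinity>, a finite value is possible only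
  if both parts have finite integrals.\<close>

lemma integrable_if_extended_expectation_finite:
  assumes F: "F \<in> borel_measurable M"
    and fin: "\<bar>extended_expectation M (\<lambda>x. ereal (F x))\<bar> \<noteq> \<infinity>"
  shows "integrable M F"
  using fin unfolding real_integrable_def extended_expectation_def
  by (cases "\<integral>\<^sup>+x. ennreal (F x) \<partial>M"; cases "\<integral>\<^sup>+x. ennreal (- F x) \<partial>M")
    (auto simp: F enn2ereal_ennreal)

section \<open>Change of the risk when a prediction is altered on a cell\<close>

text \<open>The conditional risk of predicting \<open>y\<close> on a cell; its infimum over
  \<open>y\<close> is \<open>\<phi>\<close>.\<close>

definition mixed_loss :: "('y \<Rightarrow> 'y \<Rightarrow> real) \<Rightarrow> 'y \<Rightarrow> 'y \<Rightarrow> real \<Rightarrow> 'y \<Rightarrow> real" where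
  "mixed_loss l h1 h2 p y = p * l h1 y + (1 - p) * l h2 y"

lemma measurable_loss:
  assumes "(\<lambda>(y, y'). l y y') \<in> borel_measurable (MY \<Otimes>\<^sub>M MY)" "sets P = sets (MX \<Otimes>\<^sub>M MY)"
    and "g \<in> MX \<rightarrow>\<^sub>M MY"
  shows "(\<lambda>(x, y). l y (g x)) \<in> borel_measurable P"
proof -
  have "(\<lambda>z. (snd z, g (fst z))) \<in> MX \<Otimes>\<^sub>M MY \<rightarrow>\<^sub>M MY \<Otimes>\<^sub>M MY"
    using assms(3) by measurable
  from measurable_compose[OF this assms(1)] show ?thesis
    by (simp add: measurable_cong_sets[OF assms(2) refl] split_def)
qed

lemma risk_eq_integral:
  assumes "integrable P (\<lambda>(x, y). l y (g x))"
  shows "risk l P g = ereal (\<integral>(x, y). l y (g x) \<partial>P)"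
  using extended_expectation_real[OF assms] by (simp add: risk_def split_def)

lemma integrable_loss:
  assumes "(\<lambda>(y, y'). l y y') \<in> borel_measurable (MY \<Otimes>\<^sub>M MY)" "sets P = sets (MX \<Otimes>\<^sub>M MY)"
    and "g \<in> MX \<rightarrow>\<^sub>M MY" and "\<bar>risk l P g\<bar> \<noteq> \<infinity>"
  shows "integrable P (\<lambda>(x, y). l y (g x))"
  using integrable_if_extended_expectation_finite[OF measurable_loss[OF assms(1-3)]] assms(4)
  by (simp add: risk_def split_def)

lemma mixed_loss_measurable:
  assumes "(\<lambda>(y, y'). l y y') \<in> borel_measurable (MY \<Otimes>\<^sub>M MY)" "h1 \<in> space MY" "h2 \<in> space MY"
  shows "mixed_loss l h1 h2 p \<in> borel_measurable MY"
proof -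
  have "(\<lambda>y. l h y) \<in> borel_measurable MY" if "h \<in> space MY" for h
    using measurable_compose[OF measurable_Pair1'[OF that] assms(1)] by simp
  with assms(2,3) show ?thesis
    unfolding mixed_loss_def by measurable
qed

text \<open>The two predictions differ only on \<open>A\<close>, where integrating out the label
  turns the loss into the mixed loss. The constant \<open>c\<close> lets the gain be written as a
  nonnegative integral plus a real correction. With \<open>y\<close> nearly optimal, this compares
  \<open>g\<close> with the minimal risk even where no minimiser exists.\<close>

lemma
  fixes l :: "'y \<Rightarrow> 'y \<Rightarrow> real" and P :: "('x \<times> 'y) measure"
  assumes l: "(\<lambda>(y, y'). l y y') \<in> borel_measurable (MY \<Otimes>\<^sub>M MY)"
    and P: "sets P = sets (MX \<Otimes>\<^sub>M MY)"
    and \<mu>: "finite_measure \<mu>" "sets \<mu> = sets MX"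
    and g: "g \<in> MX \<rightarrow>\<^sub>M MY" and A: "A \<in> sets MX"
    and h: "h1 \<in> space MY" "h2 \<in> space MY" and p: "0 \<le> p" "p \<le> 1" and y: "y \<in> space MY"
    and cell: "\<And>f. f \<in> borel_measurable (MX \<Otimes>\<^sub>M MY) \<Longrightarrow>
      (\<integral>\<^sup>+z. f z * indicator (A \<times> space MY) z \<partial>P)
      = (\<integral>\<^sup>+x. (ennreal p * f (x, h1) + ennreal (1 - p) * f (x, h2)) * indicator A x \<partial>\<mu>)"
    and fin: "\<bar>risk l P g\<bar> \<noteq> \<infinity>"
  shows measurable_modify: "(\<lambda>x. if x \<in> A then y else g x) \<in> MX \<rightarrow>\<^sub>M MY"
    and risk_modify_finite: "\<bar>risk l P (\<lambda>x. if x \<in> A then y else g x)\<bar> \<noteq> \<infinity>"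
    and risk_modify_le: "(\<And>x. x \<in> A \<Longrightarrow> c \<le> mixed_loss l h1 h2 p (g x)) \<Longrightarrow>
      risk l P (\<lambda>x. if x \<in> A then y else g x)
        + enn2ereal (\<integral>\<^sup>+x. ennreal (mixed_loss l h1 h2 p (g x) - c) * indicator A x \<partial>\<mu>)
      \<le> risk l P g + ereal ((mixed_loss l h1 h2 p y - c) * measure \<mu> A)"
proof -
  interpret \<mu>: finite_measure \<mu> by fact
  define g' where "g' = (\<lambda>x. if x \<in> A then y else g x)"
  define F where "F = (\<lambda>(x, y'). l y' (g x))"
  define F' where "F' = (\<lambda>(x, y'). l y' (g' x))"
  have g': "g' \<in> MX \<rightarrow>\<^sub>M MY"
    unfolding g'_def using A y by (intro measurable_If_set g measurable_const) auto
  then show "(\<lambda>x. if x \<in> A then y else g x) \<in> MX \<rightarrow>\<^sub>M MY"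
    by (simp add: g'_def)
  have space_P: "space P = space MX \<times> space MY"
    using sets_eq_imp_space_eq[OF P] by (simp add: space_pair_measure)
  have F_int: "integrable P F"
    unfolding F_def by (rule integrable_loss[OF l P g fin])
  have F'_meas: "F' \<in> borel_measurable P"
    unfolding F'_def by (rule measurable_loss[OF l P g'])
  have AY: "A \<times> space MY \<in> sets P"
    using A by (simp add: P)
  \<comment> \<open>On \<open>A\<close> the modified loss takes only the values
    \<open>l h1 y\<close> and \<open>l h2 y\<close>, so its absolute value has integral
    \<open>C\<close> times the mass of \<open>A\<close>; off \<open>A\<close> the loss is the old
    integrable one.\<close>
  define C where "C = ennreal p * ennreal \<bar>l h1 y\<bar> + ennreal (1 - p) * ennreal \<bar>l h2 y\<bar>"
  have "(\<integral>\<^sup>+z. ennreal \<bar>F' z\<bar> * indicator (A \<times> space MY) z \<partial>P) = (\<integral>\<^sup>+x. C * indicator A x \<partial>\<mu>)"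
    using F'_meas
    by (subst cell) (auto simp: measurable_cong_sets[OF P refl] F'_def g'_def C_def
        intro!: nn_integral_cong split: split_indicator)
  also have "\<dots> < \<infinity>"
    using A by (simp add: nn_integral_cmult_indicator \<mu>(2) C_def ennreal_mult_less_top \<mu>.emeasure_eq_measure)
  finally have cell_fin: "(\<integral>\<^sup>+z. ennreal \<bar>F' z\<bar> * indicator (A \<times> space MY) z \<partial>P) < \<infinity>" .
  have "(\<integral>\<^sup>+z. ennreal \<bar>F' z\<bar> \<partial>P)
      \<le> (\<integral>\<^sup>+z. ennreal \<bar>F z\<bar> + ennreal \<bar>F' z\<bar> * indicator (A \<times> space MY) z \<partial>P)"
    by (intro nn_integral_mono) (auto simp: F_def F'_def g'_def space_P split: split_indicator if_splits)
  also have "\<dots> = (\<integral>\<^sup>+z. ennreal \<bar>F z\<bar> \<partial>P) + (\<integral>\<^sup>+z. ennreal \<bar>F' z\<bar> * indicator (A \<times> space MY) z \<partial>P)"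
    using borel_measurable_integrable[OF F_int] F'_meas AY by (intro nn_integral_add) simp_all
  also have "\<dots> < \<infinity>"
    using cell_fin F_int by (simp add: integrable_iff_bounded)
  finally have F'_int: "integrable P F'"
    using F'_meas by (simp add: integrable_iff_bounded)
  have risks: "risk l P g = ereal (integral\<^sup>L P F)" "risk l P g' = ereal (integral\<^sup>L P F')"
    using risk_eq_integral[of P l g] risk_eq_integral[of P l g'] F_int F'_int
    by (simp_all add: F_def F'_def)
  then show "\<bar>risk l P (\<lambda>x. if x \<in> A then y else g x)\<bar> \<noteq> \<infinity>"
    by (simp add: g'_def)
  define L where "L = mixed_loss l h1 h2 p"
  show "risk l P (\<lambda>x. if x \<in> A then y else g x)
        + enn2ereal (\<integral>\<^sup>+x. ennreal (mixed_loss l h1 h2 p (g x) - c) * indicator A x \<partial>\<mu>)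
      \<le> risk l P g + ereal ((mixed_loss l h1 h2 p y - c) * measure \<mu> A)"
    if c: "\<And>x. x \<in> A \<Longrightarrow> c \<le> mixed_loss l h1 h2 p (g x)"
  proof -
    define D where "D z = F z - F' z" for z
    have D_int: "integrable P D"
      unfolding D_def using F_int F'_int by simp
    have D_meas: "D \<in> borel_measurable (MX \<Otimes>\<^sub>M MY)"
      using borel_measurable_integrable[OF D_int] by (simp add: measurable_cong_sets[OF P refl])
    have g_meas: "g \<in> \<mu> \<rightarrow>\<^sub>M MY"
      using g by (simp add: measurable_cong_sets[OF \<mu>(2) refl])
    have Lg_meas: "(\<lambda>x. L (g x)) \<in> borel_measurable \<mu>"
      unfolding L_def by (rule measurable_compose[OF g_meas mixed_loss_measurable[OF l h]])
    have A': "A \<in> sets \<mu>" using A \<mu>(2) by simp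
    have sect: "(\<lambda>x. D (x, h)) \<in> borel_measurable \<mu>" if "h \<in> space MY" for h
      using measurable_compose[OF measurable_Pair2'[OF that] D_meas]
      by (simp add: measurable_cong_sets[OF \<mu>(2) refl])
    define pos where "pos x = (ennreal p * ennreal (D (x, h1)) + ennreal (1 - p) * ennreal (D (x, h2))) * indicator A x" for x
    define neg where "neg x = (ennreal p * ennreal (- D (x, h1)) + ennreal (1 - p) * ennreal (- D (x, h2))) * indicator A x" for x
    \<comment> \<open>\<open>D\<close> vanishes off \<open>A\<close>, so its two parts may be
      integrated over \<open>A\<close> alone, where the label law is known.\<close>
    have pos_int: "(\<integral>\<^sup>+z. ennreal (D z) \<partial>P) = (\<integral>\<^sup>+x. pos x \<partial>\<mu>)"
    proof -
      have "(\<integral>\<^sup>+z. ennreal (D z) \<partial>P) = (\<integral>\<^sup>+z. ennreal (D z) * indicator (A \<times> space MY) z \<partial>P)"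
        by (intro nn_integral_cong) (auto simp: D_def F_def F'_def g'_def space_P split: split_indicator if_splits)
      then show ?thesis
        using D_meas by (simp add: cell pos_def)
    qed
    have neg_int: "(\<integral>\<^sup>+z. ennreal (- D z) \<partial>P) = (\<integral>\<^sup>+x. neg x \<partial>\<mu>)"
    proof -
      have "(\<integral>\<^sup>+z. ennreal (- D z) \<partial>P) = (\<integral>\<^sup>+z. ennreal (- D z) * indicator (A \<times> space MY) z \<partial>P)"
        by (intro nn_integral_cong) (auto simp: D_def F_def F'_def g'_def space_P split: split_indicator if_splits)
      then show ?thesis
        using D_meas by (simp add: cell neg_def)
    qed
    have [measurable]: "pos \<in> borel_measurable \<mu>" "neg \<in> borel_measurable \<mu>"
      unfolding pos_def neg_def using sect[OF h(1)] sect[OF h(2)] A' by measurable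
    have max_0_eq: "ennreal (max r 0) = ennreal r" for r
      by (auto simp: max_def ennreal_neg)
    have parts: "ennreal u * ennreal r + ennreal v * ennreal s
        = ennreal (u * max r 0 + v * max s 0)" if "0 \<le> u" "0 \<le> v" for u v r s :: real
      using that by (auto simp: max_def ennreal_mult ennreal_neg)
    \<comment> \<open>The real identity \<open>p * r + (1 - p) * s = L (g x) - L y\<close> with all
      negative parts moved across, so that it makes sense in \<open>ennreal\<close> and can be
      integrated term by term.\<close>
    have "ennreal (L (g x) - c) * indicator A x + neg x + ennreal (c - L y) * indicator A x
        = pos x + ennreal (L y - c) * indicator A x" for x
    proof (cases "x \<in> A")
      case True
      define r s where "r = D (x, h1)" and "s = D (x, h2)"
      have "p * r + (1 - p) * s = L (g x) - L y"
        using True by (simp add: r_def s_def D_def F_def F'_def g'_def L_def mixed_loss_def algebra_simps)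
      then have "(L (g x) - c) + (p * max (- r) 0 + (1 - p) * max (- s) 0) + max (c - L y) 0
          = (p * max r 0 + (1 - p) * max s 0) + max (L y - c) 0"
        by (auto simp: max_def algebra_simps)
      then have "ennreal ((L (g x) - c) + (p * max (- r) 0 + (1 - p) * max (- s) 0) + max (c - L y) 0)
          = ennreal ((p * max r 0 + (1 - p) * max s 0) + max (L y - c) 0)"
        by (rule arg_cong)
      then have "ennreal (L (g x) - c) + ennreal (p * max (- r) 0 + (1 - p) * max (- s) 0) + ennreal (c - L y)
          = ennreal (p * max r 0 + (1 - p) * max s 0) + ennreal (L y - c)"
        using c[OF True] p by (simp add: L_def max_0_eq)
      then show ?thesis
        using True p by (simp add: pos_def neg_def parts r_def s_def)
    qed (simp add: pos_def neg_def)
    then have "(\<integral>\<^sup>+x. ennreal (L (g x) - c) * indicator A x + neg x + ennreal (c - L y) * indicator A x \<partial>\<mu>)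
        = (\<integral>\<^sup>+x. pos x + ennreal (L y - c) * indicator A x \<partial>\<mu>)"
      by simp
    then have eq: "(\<integral>\<^sup>+x. ennreal (L (g x) - c) * indicator A x \<partial>\<mu>) + (\<integral>\<^sup>+x. neg x \<partial>\<mu>)
          + ennreal (c - L y) * emeasure \<mu> A
        = (\<integral>\<^sup>+x. pos x \<partial>\<mu>) + ennreal (L y - c) * emeasure \<mu> A"
      using A' Lg_meas by (simp add: nn_integral_add nn_integral_cmult_indicator)
    obtain a where a: "(\<integral>\<^sup>+x. pos x \<partial>\<mu>) = ennreal a" "0 \<le> a"
      using D_int pos_int by (cases "\<integral>\<^sup>+x. pos x \<partial>\<mu>") (auto simp: real_integrable_def)
    obtain b where b: "(\<integral>\<^sup>+x. neg x \<partial>\<mu>) = ennreal b" "0 \<le> b"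
      using D_int neg_int by (cases "\<integral>\<^sup>+x. neg x \<partial>\<mu>") (auto simp: real_integrable_def)
    have ab: "integral\<^sup>L P F - integral\<^sup>L P F' = a - b"
    proof -
      have "integral\<^sup>L P F - integral\<^sup>L P F' = integral\<^sup>L P D"
        unfolding D_def using F_int F'_int by simp
      also have "\<dots> = a - b"
        using a b by (simp add: real_lebesgue_integral_def[OF D_int] pos_int neg_int)
      finally show ?thesis .
    qed
    define M where "M = measure \<mu> A"
    have M: "emeasure \<mu> A = ennreal M" "0 \<le> M"
      by (simp_all add: M_def \<mu>.emeasure_eq_measure)
    have eq': "(\<integral>\<^sup>+x. ennreal (L (g x) - c) * indicator A x \<partial>\<mu>) + ennreal (b + max (c - L y) 0 * M)
        = ennreal (a + max (L y - c) 0 * M)"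
      using eq a b M by (auto simp: max_def ennreal_mult ennreal_neg add.assoc)
    obtain i where i: "(\<integral>\<^sup>+x. ennreal (L (g x) - c) * indicator A x \<partial>\<mu>) = ennreal i" "0 \<le> i"
      using eq' by (cases "\<integral>\<^sup>+x. ennreal (L (g x) - c) * indicator A x \<partial>\<mu>") auto
    have "i + (b + max (c - L y) 0 * M) = a + max (L y - c) 0 * M"
      using eq' i a b M by (simp add: ennreal_plus[symmetric] del: ennreal_plus)
    then have "integral\<^sup>L P F' + i \<le> integral\<^sup>L P F + (L y - c) * M"
      using ab by (auto simp: max_def algebra_simps split: if_splits)
    then show ?thesis
      using i risks by (simp add: g'_def[symmetric] L_def[symmetric] M_def[symmetric] enn2ereal_ennreal)
  qed
qed

section \<open>Finite and infinite edge discrepancy of type I\<close>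

text \<open>The mixed loss is affine in the probability, so at the midpoint it is the average of the
  two endpoint values. Comparing infima gives \<open>0 \<le> D\<close>, and comparing the infimum at
  the midpoint with a single \<open>y\<close> gives the pointwise gap: no prediction is nearly
  optimal for both probabilities.\<close>

lemma edge_discrepancy_I_cases:
  assumes ne: "space MY \<noteq> {}" and pq: "0 \<le> p" "p \<le> 1" "0 \<le> q" "q \<le> 1"
  obtains (infinite) "edge_discrepancy_I MY l h1 h2 p q = \<infinity>"
      "\<phi> MY l h1 h2 p = -\<infinity> \<or> \<phi> MY l h1 h2 q = -\<infinity>"
  | (finite) a b D where "edge_discrepancy_I MY l h1 h2 p q = ereal D" "0 \<le> D"
      "\<phi> MY l h1 h2 p = ereal a" "\<phi> MY l h1 h2 q = ereal b"
      "\<And>y. y \<in> space MY \<Longrightarrow> a \<le> mixed_loss l h1 h2 p y"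
      "\<And>y. y \<in> space MY \<Longrightarrow> b \<le> mixed_loss l h1 h2 q y"
      "\<And>y. y \<in> space MY \<Longrightarrow> 2 * D \<le> (mixed_loss l h1 h2 p y - a) + (mixed_loss l h1 h2 q y - b)"
proof -
  have le: "\<phi> MY l h1 h2 r \<le> ereal (mixed_loss l h1 h2 r y)" if "y \<in> space MY" for r y
    unfolding \<phi>_def mixed_loss_def using that by (intro INF_lower)
  obtain y0 where y0: "y0 \<in> space MY" using ne by auto
  have not_inf: "\<phi> MY l h1 h2 r \<noteq> \<infinity>" for r
    using le[OF y0, of r] by auto
  define mid where "mid = 1 / 2 * p + (1 - 1 / 2) * q"
  have d_I: "edge_discrepancy_I MY l h1 h2 p q
      = \<phi> MY l h1 h2 mid - ereal (1 / 2) * \<phi> MY l h1 h2 p - ereal (1 / 2) * \<phi> MY l h1 h2 q"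
    by (simp add: edge_discrepancy_I_def \<psi>_def mid_def)
  show thesis
  proof (cases "\<phi> MY l h1 h2 p = -\<infinity> \<or> \<phi> MY l h1 h2 q = -\<infinity>")
    case True
    \<comment> \<open>Subtracting -\<infinity> yields \<infinity> even if the midpoint value is
      -\<infinity>, since -\<infinity> + \<infinity> = \<infinity> in \<open>ereal\<close>.\<close>
    moreover have "edge_discrepancy_I MY l h1 h2 p q = \<infinity>"
      using True not_inf[of mid] not_inf[of p] not_inf[of q] unfolding d_I
      by (cases "\<phi> MY l h1 h2 mid"; cases "\<phi> MY l h1 h2 p"; cases "\<phi> MY l h1 h2 q") auto
    ultimately show ?thesis by (rule infinite[rotated])
  next
    case False
    then obtain a b where ab: "\<phi> MY l h1 h2 p = ereal a" "\<phi> MY l h1 h2 q = ereal b"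
      using not_inf[of p] not_inf[of q] by (cases "\<phi> MY l h1 h2 p"; cases "\<phi> MY l h1 h2 q") auto
    have a: "a \<le> mixed_loss l h1 h2 p y" and b: "b \<le> mixed_loss l h1 h2 q y" if "y \<in> space MY" for y
      using le[OF that, of p] le[OF that, of q] ab by auto
    have mixed_mid: "mixed_loss l h1 h2 mid y = (mixed_loss l h1 h2 p y + mixed_loss l h1 h2 q y) / 2" for y
      by (simp add: mixed_loss_def mid_def field_simps)
    have "ereal ((a + b) / 2) \<le> \<phi> MY l h1 h2 mid"
      unfolding \<phi>_def mixed_loss_def[symmetric]
    proof (intro INF_greatest)
      fix y assume "y \<in> space MY"
      then show "ereal ((a + b) / 2) \<le> ereal (mixed_loss l h1 h2 mid y)"
        using a[of y] b[of y] by (simp add: mixed_mid)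
    qed
    then obtain c where c: "\<phi> MY l h1 h2 mid = ereal c" "(a + b) / 2 \<le> c"
      using not_inf[of mid] by (cases "\<phi> MY l h1 h2 mid") auto
    show ?thesis
    proof (rule finite[OF _ _ ab a b])
      show "edge_discrepancy_I MY l h1 h2 p q = ereal (c - a / 2 - b / 2)"
        by (simp add: d_I ab c)
      show "0 \<le> c - a / 2 - b / 2"
        using c by (simp add: field_simps)
      show "2 * (c - a / 2 - b / 2) \<le> (mixed_loss l h1 h2 p y - a) + (mixed_loss l h1 h2 q y - b)"
        if "y \<in> space MY" for y
        using le[OF that, of mid] by (simp add: c mixed_mid)
    qed
  qed
qed

subsection \<open>Lower bounds over a hypercube\<close>

locale hypercube_estimation =
  fixes MX :: "'x measure" and MY :: "'y measure"
    and l :: "'y \<Rightarrow> 'y \<Rightarrow> real"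
    and Ps :: "(nat \<Rightarrow> bool) \<Rightarrow> ('x \<times> 'y) measure"
    and \<mu> :: "'x measure" and XX :: "nat \<Rightarrow> 'x set" and h1 h2 :: 'y
    and m n :: nat and p_plus p_minus w :: real
    and ghat :: "(nat \<Rightarrow> 'x \<times> 'y) \<Rightarrow> 'x \<Rightarrow> 'y"
  assumes loss_measurable: "(\<lambda>(y, y'). l y y') \<in> borel_measurable (MY \<Otimes>\<^sub>M MY)"
    and hypercube: "hypercube MX MY m Ps \<mu> XX h1 h2 p_plus p_minus w"
    and estimator: "estimator MX MY n ghat"
begin

definition edge_prob :: "bool \<Rightarrow> real" where
  "edge_prob s = (if s then p_plus else p_minus)"

lemma m_pos: "1 \<le> m"
  and cells_sets: "j \<le> m \<Longrightarrow> XX j \<in> sets MX"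
  and cells_disjoint: "disjoint_family_on XX {..m}"
  and cells_cover: "(\<Union>j\<le>m. XX j) = space MX"
  and cells_measure: "j \<in> {1..m} \<Longrightarrow> measure \<mu> (XX j) = w"
  and h_space: "h1 \<in> space MY" "h2 \<in> space MY"
  and h_distinct: "h1 \<noteq> h2"
  and p_bounds: "0 \<le> p_minus" "p_minus < p_plus" "p_plus \<le> 1"
  using hypercube by (simp_all add: hypercube_def)

lemma Ps: "\<sigma> \<in> sign_vectors m \<Longrightarrow> prob_space (Ps \<sigma>)"
  "\<sigma> \<in> sign_vectors m \<Longrightarrow> sets (Ps \<sigma>) = sets (MX \<Otimes>\<^sub>M MY)"
  "\<sigma> \<in> sign_vectors m \<Longrightarrow> distr (Ps \<sigma>) MX fst = \<mu>"
  using hypercube by (simp_all add: hypercube_def)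

lemma edge_prob_bounds: "0 \<le> edge_prob s" "edge_prob s \<le> 1"
  using p_bounds by (auto simp: edge_prob_def)

lemma sign_vector_const: "(\<lambda>j\<in>{1..m}. s) \<in> sign_vectors m"
  by (simp add: sign_vectors_def)

lemma sign_vector_upd: "\<sigma> \<in> sign_vectors m \<Longrightarrow> j \<in> {1..m} \<Longrightarrow> \<sigma>(j := s) \<in> sign_vectors m"
  by (auto simp: sign_vectors_def PiE_def extensional_def)

lemma sets_\<mu>: "sets \<mu> = sets MX" and space_\<mu>: "space \<mu> = space MX"
  by (subst Ps(3)[OF sign_vector_const[of True], symmetric], simp)+

lemma prob_\<mu>: "prob_space \<mu>"
proof -
  have "fst \<in> Ps (\<lambda>j\<in>{1..m}. True) \<rightarrow>\<^sub>M MX"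
    unfolding measurable_cong_sets[OF Ps(2)[OF sign_vector_const] refl] by (rule measurable_fst)
  then show ?thesis
    using prob_space.prob_space_distr[OF Ps(1)[OF sign_vector_const]] Ps(3)[OF sign_vector_const]
    by metis
qed

lemma w_bounds: "0 \<le> w" "w \<le> 1"
  using cells_measure[of 1] m_pos prob_space.prob_le_1[OF prob_\<mu>, of "XX 1"]
    measure_nonneg[of \<mu> "XX 1"] by auto

section \<open>Label laws on and off a cell\<close>

lemma kernel:
  obtains K where "\<And>\<sigma>. \<sigma> \<in> sign_vectors m \<Longrightarrow> conditional_distribution MX MY (Ps \<sigma>) (K \<sigma>)"
    "\<And>\<sigma> j x f. \<sigma> \<in> sign_vectors m \<Longrightarrow> j \<in> {1..m} \<Longrightarrow> x \<in> XX j \<Longrightarrow> f \<in> borel_measurable MY \<Longrightarrow>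
      (\<integral>\<^sup>+y. f y \<partial>K \<sigma> x) = ennreal (edge_prob (\<sigma> j)) * f h1 + ennreal (1 - edge_prob (\<sigma> j)) * f h2"
    "\<And>\<sigma> \<tau> x. \<sigma> \<in> sign_vectors m \<Longrightarrow> \<tau> \<in> sign_vectors m \<Longrightarrow> x \<in> XX 0 \<Longrightarrow> K \<sigma> x = K \<tau> x"
proof -
  have "\<exists>K. (\<forall>\<sigma> \<in> sign_vectors m. conditional_distribution MX MY (Ps \<sigma>) (K \<sigma>)) \<and>
      (\<forall>\<sigma> \<in> sign_vectors m. \<forall>j \<in> {1..m}. \<forall>x \<in> XX j.
         measure (K \<sigma> x) {h1} = (if \<sigma> j then p_plus else p_minus) \<and>
         1 - measure (K \<sigma> x) {h2} = (if \<sigma> j then p_plus else p_minus)) \<and>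
      (\<forall>\<sigma> \<in> sign_vectors m. \<forall>\<tau> \<in> sign_vectors m. \<forall>x \<in> XX 0. K \<sigma> x = K \<tau> x)"
    using hypercube unfolding hypercube_def by (elim conjE)
  then obtain K where K0: "\<forall>\<sigma> \<in> sign_vectors m. conditional_distribution MX MY (Ps \<sigma>) (K \<sigma>)"
    "\<forall>\<sigma> \<in> sign_vectors m. \<forall>j \<in> {1..m}. \<forall>x \<in> XX j.
         measure (K \<sigma> x) {h1} = edge_prob (\<sigma> j) \<and> 1 - measure (K \<sigma> x) {h2} = edge_prob (\<sigma> j)"
    "\<forall>\<sigma> \<in> sign_vectors m. \<forall>\<tau> \<in> sign_vectors m. \<forall>x \<in> XX 0. K \<sigma> x = K \<tau> x"
    unfolding edge_prob_def by (elim exE conjE)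
  note K = bspec[OF K0(1)] conjunct1[OF bspec[OF bspec[OF bspec[OF K0(2)]]]]
    conjunct2[OF bspec[OF bspec[OF bspec[OF K0(2)]]]] bspec[OF bspec[OF bspec[OF K0(3)]]]
  have K_prob: "prob_space (K \<sigma> x)" "sets (K \<sigma> x) = sets MY"
    if "\<sigma> \<in> sign_vectors m" "x \<in> space MX" for \<sigma> x
    using K(1)[OF that(1)] that(2) measurable_space[of "K \<sigma>" MX "prob_algebra MY" x]
    by (auto simp: conditional_distribution_def space_prob_algebra)
  show thesis
  proof (rule that[OF K(1) _ K(4)])
    fix \<sigma> j x and f :: "'y \<Rightarrow> ennreal"
    assume \<sigma>: "\<sigma> \<in> sign_vectors m" and j: "j \<in> {1..m}" and x: "x \<in> XX j" and f: "f \<in> borel_measurable MY"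
    have xs: "x \<in> space MX"
      using sets.sets_into_space[OF cells_sets[of j]] j x by auto
    \<comment> \<open>Under \<sigma> itself one of the two atoms may have mass 0. The constant
      vectors give positive mass: \<open>p_plus\<close> to \<open>h1\<close> and
      \<open>1 - p_minus\<close> to \<open>h2\<close>.\<close>
    define \<tau> :: "bool \<Rightarrow> nat \<Rightarrow> bool" where "\<tau> s = (\<lambda>j\<in>{1..m}. s)" for s
    have \<tau>: "\<tau> s \<in> sign_vectors m" for s
      unfolding \<tau>_def by (rule sign_vector_const)
    \<comment> \<open>A non-measurable set has measure 0, so both atoms are measurable.\<close>
    have "measure (K (\<tau> True) x) {h1} \<noteq> 0"
      using K(2)[OF \<tau>[of True] j x] j p_bounds by (simp add: \<tau>_def edge_prob_def)
    then have h1: "{h1} \<in> sets MY"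
      using measure_notin_sets[of "{h1}" "K (\<tau> True) x"] K_prob(2)[OF \<tau> xs] by auto
    have "measure (K (\<tau> False) x) {h2} \<noteq> 0"
      using K(3)[OF \<tau>[of False] j x] j p_bounds by (simp add: \<tau>_def edge_prob_def)
    then have h2: "{h2} \<in> sets MY"
      using measure_notin_sets[of "{h2}" "K (\<tau> False) x"] K_prob(2)[OF \<tau> xs] by auto
    show "(\<integral>\<^sup>+y. f y \<partial>K \<sigma> x) = ennreal (edge_prob (\<sigma> j)) * f h1 + ennreal (1 - edge_prob (\<sigma> j)) * f h2"
      using K_prob[OF \<sigma> xs] h1 h2 h_distinct f K(2,3)[OF \<sigma> j x]
      by (intro nn_integral_two_atoms) (auto simp: measurable_cong_sets[OF K_prob(2)[OF \<sigma> xs] refl])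
  qed auto
qed

text \<open>On \<open>A\<close> every label law is the same two-point law. \<open>A\<close> may be a
  union of cells, so that all cells of one sign can be treated at once.\<close>

lemma nn_integral_cell:
  assumes \<sigma>: "\<sigma> \<in> sign_vectors m" and A: "A \<in> sets MX"
    and cell: "\<And>x. x \<in> A \<Longrightarrow> \<exists>j\<in>{1..m}. x \<in> XX j \<and> edge_prob (\<sigma> j) = p"
    and f: "f \<in> borel_measurable (MX \<Otimes>\<^sub>M MY)"
  shows "(\<integral>\<^sup>+z. f z * indicator (A \<times> space MY) z \<partial>Ps \<sigma>)
    = (\<integral>\<^sup>+x. (ennreal p * f (x, h1) + ennreal (1 - p) * f (x, h2)) * indicator A x \<partial>\<mu>)"
proof -
  obtain K where K: "\<And>\<sigma>. \<sigma> \<in> sign_vectors m \<Longrightarrow> conditional_distribution MX MY (Ps \<sigma>) (K \<sigma>)"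
    "\<And>\<sigma> j x f. \<sigma> \<in> sign_vectors m \<Longrightarrow> j \<in> {1..m} \<Longrightarrow> x \<in> XX j \<Longrightarrow> f \<in> borel_measurable MY \<Longrightarrow>
      (\<integral>\<^sup>+y. f y \<partial>K \<sigma> x) = ennreal (edge_prob (\<sigma> j)) * f h1 + ennreal (1 - edge_prob (\<sigma> j)) * f h2"
    "\<And>\<sigma> \<tau> x. \<sigma> \<in> sign_vectors m \<Longrightarrow> \<tau> \<in> sign_vectors m \<Longrightarrow> x \<in> XX 0 \<Longrightarrow> K \<sigma> x = K \<tau> x"
    by (rule kernel) blast
  define F where "F z = f z * indicator (A \<times> space MY) z" for z
  have F: "F \<in> borel_measurable (MX \<Otimes>\<^sub>M MY)"
    unfolding F_def using f A by measurable
  have "(\<integral>\<^sup>+z. F z \<partial>Ps \<sigma>) = (\<integral>\<^sup>+x. \<integral>\<^sup>+y. F (x, y) \<partial>K \<sigma> x \<partial>\<mu>)"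
    using nn_integral_conditional_distribution[OF Ps(1,2)[OF \<sigma>] K(1)[OF \<sigma>] F] Ps(3)[OF \<sigma>] by simp
  also have "\<dots> = (\<integral>\<^sup>+x. (ennreal p * f (x, h1) + ennreal (1 - p) * f (x, h2)) * indicator A x \<partial>\<mu>)"
  proof (rule nn_integral_cong)
    fix x assume "x \<in> space \<mu>"
    then have x: "x \<in> space MX" by (simp add: space_\<mu>)
    show "(\<integral>\<^sup>+y. F (x, y) \<partial>K \<sigma> x) = (ennreal p * f (x, h1) + ennreal (1 - p) * f (x, h2)) * indicator A x"
    proof (cases "x \<in> A")
      case True
      then obtain j where j: "j \<in> {1..m}" "x \<in> XX j" "edge_prob (\<sigma> j) = p"
        using cell by blast
      show ?thesis
        using K(2)[OF \<sigma> j(1,2) measurable_compose[OF measurable_Pair1'[OF x] F]] True h_space j(3)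
        by (simp add: F_def)
    qed (simp add: F_def)
  qed
  finally show ?thesis by (simp add: F_def)
qed

text \<open>Off \<open>XX j\<close> the kernels agree in effect: on \<open>XX 0\<close> by
  assumption, and on any other cell because equal signs give the same two-point law.\<close>

lemma nn_integral_off_cell:
  assumes \<sigma>: "\<sigma> \<in> sign_vectors m" and \<tau>: "\<tau> \<in> sign_vectors m" and j: "j \<in> {1..m}"
    and eq: "\<And>i. i \<noteq> j \<Longrightarrow> \<sigma> i = \<tau> i"
    and f: "f \<in> borel_measurable (MX \<Otimes>\<^sub>M MY)"
  shows "(\<integral>\<^sup>+z. f z * indicator ((space MX - XX j) \<times> space MY) z \<partial>Ps \<sigma>)
    = (\<integral>\<^sup>+z. f z * indicator ((space MX - XX j) \<times> space MY) z \<partial>Ps \<tau>)"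
proof -
  obtain K where K: "\<And>\<sigma>. \<sigma> \<in> sign_vectors m \<Longrightarrow> conditional_distribution MX MY (Ps \<sigma>) (K \<sigma>)"
    "\<And>\<sigma> j x f. \<sigma> \<in> sign_vectors m \<Longrightarrow> j \<in> {1..m} \<Longrightarrow> x \<in> XX j \<Longrightarrow> f \<in> borel_measurable MY \<Longrightarrow>
      (\<integral>\<^sup>+y. f y \<partial>K \<sigma> x) = ennreal (edge_prob (\<sigma> j)) * f h1 + ennreal (1 - edge_prob (\<sigma> j)) * f h2"
    "\<And>\<sigma> \<tau> x. \<sigma> \<in> sign_vectors m \<Longrightarrow> \<tau> \<in> sign_vectors m \<Longrightarrow> x \<in> XX 0 \<Longrightarrow> K \<sigma> x = K \<tau> x"
    by (rule kernel) blast
  have X: "XX j \<in> sets MX"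
    using cells_sets[of j] j by simp
  define F where "F z = f z * indicator ((space MX - XX j) \<times> space MY) z" for z
  have F: "F \<in> borel_measurable (MX \<Otimes>\<^sub>M MY)"
    unfolding F_def using f X by measurable
  have "(\<integral>\<^sup>+y. F (x, y) \<partial>K \<sigma> x) = (\<integral>\<^sup>+y. F (x, y) \<partial>K \<tau> x)" if xs: "x \<in> space MX" for x
  proof (cases "x \<in> XX j")
    case False
    obtain i where i: "i \<le> m" "x \<in> XX i"
      using xs cells_cover by auto
    show ?thesis
    proof (cases "i = 0")
      case True
      then show ?thesis using K(3)[OF \<sigma> \<tau>] i by simp
    next
      case i0: False
      have "i \<noteq> j" "i \<in> {1..m}" using i False i0 by auto
      then show ?thesis
        using K(2)[OF \<sigma> _ i(2) measurable_compose[OF measurable_Pair1'[OF xs] F]]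
          K(2)[OF \<tau> _ i(2) measurable_compose[OF measurable_Pair1'[OF xs] F]] eq[of i]
        by simp
    qed
  qed (simp add: F_def)
  then have "(\<integral>\<^sup>+z. F z \<partial>Ps \<sigma>) = (\<integral>\<^sup>+z. F z \<partial>Ps \<tau>)"
    using nn_integral_conditional_distribution[OF Ps(1,2)[OF \<sigma>] K(1)[OF \<sigma>] F] Ps(3)[OF \<sigma>]
      nn_integral_conditional_distribution[OF Ps(1,2)[OF \<tau>] K(1)[OF \<tau>] F] Ps(3)[OF \<tau>]
    by (auto simp: space_\<mu> intro: nn_integral_cong)
  then show ?thesis by (simp add: F_def)
qed

text \<open>The laws for \<sigma> and its flip at \<open>j\<close> are mixtures of the same three
  pieces and differ only in the label weights on \<open>XX j\<close>; the bound for product measures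
  then applies.\<close>

lemma overlap_flip:
  assumes \<sigma>: "\<sigma> \<in> sign_vectors m" and j: "j \<in> {1..m}" and \<sigma>j: "\<sigma> j"
    and A: "A \<in> borel_measurable (PiM {..<n} (\<lambda>_. MX \<Otimes>\<^sub>M MY))"
    and B: "B \<in> borel_measurable (PiM {..<n} (\<lambda>_. MX \<Otimes>\<^sub>M MY))"
    and c: "\<And>z. z \<in> space (PiM {..<n} (\<lambda>_. MX \<Otimes>\<^sub>M MY)) \<Longrightarrow> c \<le> A z + B z"
  shows "c * ennreal (overlap w p_plus p_minus n 1 1)
    \<le> (\<integral>\<^sup>+z. A z \<partial>PiM {..<n} (\<lambda>_. Ps \<sigma>)) + (\<integral>\<^sup>+z. B z \<partial>PiM {..<n} (\<lambda>_. Ps (\<sigma>(j := False))))"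
proof -
  define \<tau> where "\<tau> = \<sigma>(j := False)"
  have \<tau>: "\<tau> \<in> sign_vectors m"
    unfolding \<tau>_def using \<sigma> j by (rule sign_vector_upd)
  interpret \<mu>: prob_space \<mu> by (rule prob_\<mu>)
  have X: "XX j \<in> sets MX"
    using cells_sets[of j] j by simp
  have X_sub: "XX j \<subseteq> space MX"
    using X by (rule sets.sets_into_space)
  define S where "S = (space MX - XX j) \<times> space MY"
  have S: "S \<in> sets (MX \<Otimes>\<^sub>M MY)"
    unfolding S_def using X by auto
  \<comment> \<open>\<open>\<kappa>0\<close> is the common law off the cell, of mass
    \<open>1 - w\<close>; \<open>\<kappa> h\<close> is the input law on the cell with the label
    fixed to \<open>h\<close>, of mass \<open>w\<close>.\<close>
  define \<kappa>0 where "\<kappa>0 = density (Ps \<sigma>) (indicator S)"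
  define \<kappa> where "\<kappa> h = distr (density \<mu> (indicator (XX j))) (MX \<Otimes>\<^sub>M MY) (\<lambda>x. (x, h))" for h
  have \<kappa>_sets: "sets \<kappa>0 = sets (MX \<Otimes>\<^sub>M MY)" "sets (\<kappa> h) = sets (MX \<Otimes>\<^sub>M MY)" for h
    by (simp_all add: \<kappa>0_def \<kappa>_def Ps(2)[OF \<sigma>])
  have \<kappa>0_int: "(\<integral>\<^sup>+z. f z \<partial>\<kappa>0) = (\<integral>\<^sup>+z. f z * indicator S z \<partial>Ps \<sigma>)"
    if "f \<in> borel_measurable (MX \<Otimes>\<^sub>M MY)" for f
    unfolding \<kappa>0_def using S that
    by (subst nn_integral_density)
       (auto simp: Ps(2)[OF \<sigma>] measurable_cong_sets[OF Ps(2)[OF \<sigma>] refl] mult.commute)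
  have \<kappa>_int: "(\<integral>\<^sup>+z. f z \<partial>\<kappa> h) = (\<integral>\<^sup>+x. f (x, h) * indicator (XX j) x \<partial>\<mu>)"
    if f: "f \<in> borel_measurable (MX \<Otimes>\<^sub>M MY)" and h: "h \<in> space MY" for f h
  proof -
    have pair: "(\<lambda>x. (x, h)) \<in> \<mu> \<rightarrow>\<^sub>M MX \<Otimes>\<^sub>M MY"
      unfolding measurable_cong_sets[OF sets_\<mu> refl] using h by (rule measurable_Pair2')
    have "(\<integral>\<^sup>+z. f z \<partial>\<kappa> h) = (\<integral>\<^sup>+x. f (x, h) \<partial>density \<mu> (indicator (XX j)))"
      unfolding \<kappa>_def using pair f by (intro nn_integral_distr) auto
    also have "\<dots> = (\<integral>\<^sup>+x. indicator (XX j) x * f (x, h) \<partial>\<mu>)"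
      using X measurable_compose[OF pair f] by (intro nn_integral_density) (auto simp: sets_\<mu> intro!: borel_measurable_indicator)
    finally show ?thesis by (simp add: mult.commute)
  qed
  have mass_S: "emeasure (Ps \<sigma>) S = ennreal (1 - w)"
  proof -
    have fst: "fst \<in> Ps \<sigma> \<rightarrow>\<^sub>M MX"
      unfolding measurable_cong_sets[OF Ps(2)[OF \<sigma>] refl] by (rule measurable_fst)
    have space_P: "space (Ps \<sigma>) = space MX \<times> space MY"
      using sets_eq_imp_space_eq[OF Ps(2)[OF \<sigma>]] by (simp add: space_pair_measure)
    have "emeasure \<mu> (space MX - XX j) = emeasure (Ps \<sigma>) (fst -` (space MX - XX j) \<inter> space (Ps \<sigma>))"
      unfolding Ps(3)[OF \<sigma>, symmetric] using X fst by (intro emeasure_distr) auto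
    also have "fst -` (space MX - XX j) \<inter> space (Ps \<sigma>) = S"
      by (auto simp: S_def space_P)
    finally show ?thesis
      using \<mu>.prob_compl[of "XX j"] X cells_measure[OF j]
      by (simp add: \<mu>.emeasure_eq_measure sets_\<mu> space_\<mu>)
  qed
  have mass: "emeasure \<kappa>0 (space (MX \<Otimes>\<^sub>M MY)) = ennreal (1 - w)"
    "h \<in> space MY \<Longrightarrow> emeasure (\<kappa> h) (space (MX \<Otimes>\<^sub>M MY)) = ennreal w" for h
  proof -
    have "emeasure \<kappa>0 (space \<kappa>0) = (\<integral>\<^sup>+z. 1 \<partial>\<kappa>0)"
      by simp
    also have "\<dots> = ennreal (1 - w)"
      using S by (subst \<kappa>0_int) (auto simp: Ps(2)[OF \<sigma>] mass_S)
    finally show "emeasure \<kappa>0 (space (MX \<Otimes>\<^sub>M MY)) = ennreal (1 - w)"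
      by (simp add: sets_eq_imp_space_eq[OF \<kappa>_sets(1)])
    assume h: "h \<in> space MY"
    have "emeasure (\<kappa> h) (space (\<kappa> h)) = (\<integral>\<^sup>+z. 1 \<partial>\<kappa> h)"
      by simp
    also have "\<dots> = ennreal w"
      using X h cells_measure[OF j] by (subst \<kappa>_int) (auto simp: sets_\<mu> \<mu>.emeasure_eq_measure)
    finally show "emeasure (\<kappa> h) (space (MX \<Otimes>\<^sub>M MY)) = ennreal w"
      by (simp add: sets_eq_imp_space_eq[OF \<kappa>_sets(2)])
  qed
  have decomp: "(\<integral>\<^sup>+z. f z \<partial>Ps \<rho>) = (\<integral>\<^sup>+z. f z \<partial>\<kappa>0)
      + (ennreal (edge_prob (\<rho> j)) * (\<integral>\<^sup>+z. f z \<partial>\<kappa> h1) + ennreal (1 - edge_prob (\<rho> j)) * (\<integral>\<^sup>+z. f z \<partial>\<kappa> h2))"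
    if \<rho>: "\<rho> \<in> sign_vectors m" and eq: "\<And>i. i \<noteq> j \<Longrightarrow> \<rho> i = \<sigma> i"
      and f: "f \<in> borel_measurable (MX \<Otimes>\<^sub>M MY)" for \<rho> f
  proof -
    define T where "T = XX j \<times> space MY"
    have T: "T \<in> sets (MX \<Otimes>\<^sub>M MY)"
      unfolding T_def using X by auto
    have space_P: "space (Ps \<rho>) = space MX \<times> space MY"
      using sets_eq_imp_space_eq[OF Ps(2)[OF \<rho>]] by (simp add: space_pair_measure)
    have sect: "(\<lambda>x. f (x, h)) \<in> borel_measurable \<mu>" if "h \<in> space MY" for h
      unfolding measurable_cong_sets[OF sets_\<mu> refl]
      by (rule measurable_compose[OF measurable_Pair2'[OF that] f])
    have "(\<integral>\<^sup>+z. f z \<partial>Ps \<rho>) = (\<integral>\<^sup>+z. f z * indicator S z + f z * indicator T z \<partial>Ps \<rho>)"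
      by (intro nn_integral_cong) (auto simp: S_def T_def space_P split: split_indicator)
    also have "\<dots> = (\<integral>\<^sup>+z. f z * indicator S z \<partial>Ps \<rho>) + (\<integral>\<^sup>+z. f z * indicator T z \<partial>Ps \<rho>)"
      using f S T by (intro nn_integral_add)
        (auto simp: measurable_cong_sets[OF Ps(2)[OF \<rho>] refl] Ps(2)[OF \<rho>])
    also have "(\<integral>\<^sup>+z. f z * indicator S z \<partial>Ps \<rho>) = (\<integral>\<^sup>+z. f z \<partial>\<kappa>0)"
      unfolding \<kappa>0_int[OF f] S_def using nn_integral_off_cell[OF \<rho> \<sigma> j eq f] by simp
    also have "(\<integral>\<^sup>+z. f z * indicator T z \<partial>Ps \<rho>)
        = (\<integral>\<^sup>+x. (ennreal (edge_prob (\<rho> j)) * f (x, h1) + ennreal (1 - edge_prob (\<rho> j)) * f (x, h2)) * indicator (XX j) x \<partial>\<mu>)"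
      unfolding T_def using j by (intro nn_integral_cell[OF \<rho> X _ f]) auto
    also have "\<dots> = (\<integral>\<^sup>+x. ennreal (edge_prob (\<rho> j)) * (f (x, h1) * indicator (XX j) x)
        + ennreal (1 - edge_prob (\<rho> j)) * (f (x, h2) * indicator (XX j) x) \<partial>\<mu>)"
      by (simp add: distrib_right mult.assoc)
    also have "\<dots> = ennreal (edge_prob (\<rho> j)) * (\<integral>\<^sup>+z. f z \<partial>\<kappa> h1) + ennreal (1 - edge_prob (\<rho> j)) * (\<integral>\<^sup>+z. f z \<partial>\<kappa> h2)"
      using X[folded sets_\<mu>] sect[OF h_space(1)] sect[OF h_space(2)]
      by (simp add: \<kappa>_int f h_space nn_integral_add nn_integral_cmult)
    finally show ?thesis .
  qed
  have "c * ennreal (overlap w p_plus p_minus n 1 1)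
    \<le> ennreal 1 * (\<integral>\<^sup>+z. A z \<partial>PiM {..<n} (\<lambda>_. Ps \<sigma>)) + ennreal 1 * (\<integral>\<^sup>+z. B z \<partial>PiM {..<n} (\<lambda>_. Ps \<tau>))"
  proof (rule overlap_le_nn_integral_PiM[OF Ps(1,2)[OF \<sigma>] Ps(1,2)[OF \<tau>] \<kappa>_sets(1) \<kappa>_sets(2) \<kappa>_sets(2)
        mass(1) mass(2)[OF h_space(1)] mass(2)[OF h_space(2)] _ _ w_bounds _ _ _ _ _ _ A B c])
    show "(\<integral>\<^sup>+z. f z \<partial>Ps \<sigma>) = (\<integral>\<^sup>+z. f z \<partial>\<kappa>0)
      + (ennreal p_plus * (\<integral>\<^sup>+z. f z \<partial>\<kappa> h1) + ennreal (1 - p_plus) * (\<integral>\<^sup>+z. f z \<partial>\<kappa> h2))"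
      if "f \<in> borel_measurable (MX \<Otimes>\<^sub>M MY)" for f
      using decomp[OF \<sigma> _ that] \<sigma>j by (simp add: edge_prob_def)
    show "(\<integral>\<^sup>+z. f z \<partial>Ps \<tau>) = (\<integral>\<^sup>+z. f z \<partial>\<kappa>0)
      + (ennreal p_minus * (\<integral>\<^sup>+z. f z \<partial>\<kappa> h1) + ennreal (1 - p_minus) * (\<integral>\<^sup>+z. f z \<partial>\<kappa> h2))"
      if "f \<in> borel_measurable (MX \<Otimes>\<^sub>M MY)" for f
      using decomp[OF \<tau> _ that] by (simp add: edge_prob_def \<tau>_def)
  qed (use p_bounds in auto)
  then show ?thesis
    by (simp add: \<tau>_def)
qed

section \<open>Regret under a single distribution\<close>

lemma sets_training:
  "\<sigma> \<in> sign_vectors m \<Longrightarrow> sets (PiM {..<n} (\<lambda>_. Ps \<sigma>)) = sets (PiM {..<n} (\<lambda>_. MX \<Otimes>\<^sub>M MY))"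
  by (rule sets_PiM_cong[OF refl Ps(2)])

lemma prob_space_training:
  assumes \<sigma>: "\<sigma> \<in> sign_vectors m"
  shows "prob_space (PiM {..<n} (\<lambda>_. Ps \<sigma>))"
  using Ps(1)[OF \<sigma>] by (intro prob_space_PiM)

lemma ghat_measurable:
  assumes "z \<in> space (PiM {..<n} (\<lambda>_. MX \<Otimes>\<^sub>M MY))"
  shows "ghat z \<in> MX \<rightarrow>\<^sub>M MY"
  using measurable_compose[OF measurable_Pair1'[OF assms] estimator[unfolded estimator_def]] by simp

lemma borel_measurable_risk_ghat:
  assumes \<sigma>: "\<sigma> \<in> sign_vectors m"
  shows "(\<lambda>z. risk l (Ps \<sigma>) (ghat z)) \<in> borel_measurable (PiM {..<n} (\<lambda>_. MX \<Otimes>\<^sub>M MY))"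
proof -
  interpret P: prob_space "Ps \<sigma>" by (rule Ps(1)[OF \<sigma>])
  let ?T = "PiM {..<n} (\<lambda>_. MX \<Otimes>\<^sub>M MY)"
  have "(\<lambda>u. (\<lambda>(z, x). ghat z x) (fst u, fst (snd u))) \<in> ?T \<Otimes>\<^sub>M (MX \<Otimes>\<^sub>M MY) \<rightarrow>\<^sub>M MY"
    by (rule measurable_compose[OF _ estimator[unfolded estimator_def]]) simp
  then have "(\<lambda>u. (snd (snd u), ghat (fst u) (fst (snd u)))) \<in> ?T \<Otimes>\<^sub>M (MX \<Otimes>\<^sub>M MY) \<rightarrow>\<^sub>M MY \<Otimes>\<^sub>M MY"
    by (intro measurable_Pair) auto
  from measurable_compose[OF this loss_measurable]
  have L: "(\<lambda>u. l (snd (snd u)) (ghat (fst u) (fst (snd u)))) \<in> borel_measurable (?T \<Otimes>\<^sub>M Ps \<sigma>)"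
    by (simp add: measurable_cong_sets[OF sets_pair_measure_cong[OF refl Ps(2)[OF \<sigma>]] refl])
  then have pos: "(\<lambda>(z, u). ennreal (l (snd u) (ghat z (fst u)))) \<in> borel_measurable (?T \<Otimes>\<^sub>M Ps \<sigma>)"
    and neg: "(\<lambda>(z, u). ennreal (- l (snd u) (ghat z (fst u)))) \<in> borel_measurable (?T \<Otimes>\<^sub>M Ps \<sigma>)"
    by (simp_all add: split_def)
  show ?thesis
    using P.borel_measurable_nn_integral[OF pos] P.borel_measurable_nn_integral[OF neg]
    unfolding risk_def extended_expectation_def by (simp add: split_def)
qed

lemma minimal_risk_le:
  "g \<in> MX \<rightarrow>\<^sub>M MY \<Longrightarrow> minimal_risk MX MY l P \<le> risk l P g"
  unfolding minimal_risk_def by (rule INF_lower)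

text \<open>A regret other than \<infinity> excludes expected risk \<infinity> and minimal risk
  -\<infinity>. Hence some training set yields a prediction of risk below \<infinity>, and the
  minimal risk bounds it from below.\<close>

lemma regret_finiteD:
  assumes \<sigma>: "\<sigma> \<in> sign_vectors m"
    and fin: "expected_risk l n (Ps \<sigma>) ghat - minimal_risk MX MY l (Ps \<sigma>) \<noteq> \<infinity>"
  obtains r g where "minimal_risk MX MY l (Ps \<sigma>) = ereal r" "g \<in> MX \<rightarrow>\<^sub>M MY" "\<bar>risk l (Ps \<sigma>) g\<bar> \<noteq> \<infinity>"
proof -
  interpret T: prob_space "PiM {..<n} (\<lambda>_. Ps \<sigma>)" by (rule prob_space_training[OF \<sigma>])
  have min: "minimal_risk MX MY l (Ps \<sigma>) \<noteq> -\<infinity>" and exp: "expected_risk l n (Ps \<sigma>) ghat \<noteq> \<infinity>"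
    using fin by auto
  \<comment> \<open>Were the risk infinite for every training set, its positive part would have
    infinite integral.\<close>
  have "\<exists>z \<in> space (PiM {..<n} (\<lambda>_. Ps \<sigma>)). risk l (Ps \<sigma>) (ghat z) \<noteq> \<infinity>"
  proof (rule ccontr)
    assume "\<not> ?thesis"
    then have "(\<integral>\<^sup>+z. e2ennreal (risk l (Ps \<sigma>) (ghat z)) \<partial>PiM {..<n} (\<lambda>_. Ps \<sigma>))
        = (\<integral>\<^sup>+z. \<top> \<partial>PiM {..<n} (\<lambda>_. Ps \<sigma>))"
      by (intro nn_integral_cong) simp
    then have "(\<integral>\<^sup>+z. e2ennreal (risk l (Ps \<sigma>) (ghat z)) \<partial>PiM {..<n} (\<lambda>_. Ps \<sigma>)) = \<top>"
      by (simp add: T.emeasure_space_1)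
    then have "expected_risk l n (Ps \<sigma>) ghat = \<infinity>"
      by (simp add: expected_risk_def extended_expectation_def)
    with exp show False ..
  qed
  then obtain z where z: "z \<in> space (PiM {..<n} (\<lambda>_. MX \<Otimes>\<^sub>M MY))" "risk l (Ps \<sigma>) (ghat z) \<noteq> \<infinity>"
    using sets_eq_imp_space_eq[OF sets_training[OF \<sigma>]] by auto
  have le: "minimal_risk MX MY l (Ps \<sigma>) \<le> risk l (Ps \<sigma>) (ghat z)"
    by (rule minimal_risk_le[OF ghat_measurable[OF z(1)]])
  then obtain r where r: "minimal_risk MX MY l (Ps \<sigma>) = ereal r"
    using min z(2) by (cases "minimal_risk MX MY l (Ps \<sigma>)") auto
  have "\<bar>risk l (Ps \<sigma>) (ghat z)\<bar> \<noteq> \<infinity>"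
    using le z(2) r by auto
  with r ghat_measurable[OF z(1)] show thesis by (rule that)
qed

text \<open>Passes from a pointwise bound on the excess risk to its mean; since \<open>r\<close> is
  real, it can be subtracted safely.\<close>

lemma regret_ge:
  assumes \<sigma>: "\<sigma> \<in> sign_vectors m" and r: "minimal_risk MX MY l (Ps \<sigma>) = ereal r"
    and h: "h \<in> borel_measurable (PiM {..<n} (\<lambda>_. MX \<Otimes>\<^sub>M MY))"
    and le: "\<And>z. z \<in> space (PiM {..<n} (\<lambda>_. MX \<Otimes>\<^sub>M MY)) \<Longrightarrow> ereal r + enn2ereal (h z) \<le> risk l (Ps \<sigma>) (ghat z)"
  shows "enn2ereal (\<integral>\<^sup>+z. h z \<partial>PiM {..<n} (\<lambda>_. Ps \<sigma>))
    \<le> expected_risk l n (Ps \<sigma>) ghat - minimal_risk MX MY l (Ps \<sigma>)"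
proof -
  have "ereal r + enn2ereal (\<integral>\<^sup>+z. h z \<partial>PiM {..<n} (\<lambda>_. Ps \<sigma>)) \<le> expected_risk l n (Ps \<sigma>) ghat"
    unfolding expected_risk_def
  proof (rule extended_expectation_ge[OF prob_space_training[OF \<sigma>]])
    show "(\<lambda>z. risk l (Ps \<sigma>) (ghat z)) \<in> borel_measurable (PiM {..<n} (\<lambda>_. Ps \<sigma>))"
      unfolding measurable_cong_sets[OF sets_training[OF \<sigma>] refl] by (rule borel_measurable_risk_ghat[OF \<sigma>])
    show "h \<in> borel_measurable (PiM {..<n} (\<lambda>_. Ps \<sigma>))"
      unfolding measurable_cong_sets[OF sets_training[OF \<sigma>] refl] by (rule h)
  qed (simp add: le sets_eq_imp_space_eq[OF sets_training[OF \<sigma>]])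
  then show ?thesis
    unfolding r
    by (cases "expected_risk l n (Ps \<sigma>) ghat"; cases "enn2ereal (\<integral>\<^sup>+z. h z \<partial>PiM {..<n} (\<lambda>_. Ps \<sigma>))") auto
qed

lemma regret_nonneg:
  assumes \<sigma>: "\<sigma> \<in> sign_vectors m"
  shows "0 \<le> expected_risk l n (Ps \<sigma>) ghat - minimal_risk MX MY l (Ps \<sigma>)"
proof (cases "expected_risk l n (Ps \<sigma>) ghat - minimal_risk MX MY l (Ps \<sigma>) = \<infinity>")
  case False
  then obtain r where r: "minimal_risk MX MY l (Ps \<sigma>) = ereal r"
    using regret_finiteD[OF \<sigma>] by blast
  show ?thesis
    using regret_ge[OF \<sigma> r, of "\<lambda>_. 0"] minimal_risk_le[OF ghat_measurable, of _ "Ps \<sigma>"]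
    by (simp add: r zero_ennreal.rep_eq)
qed simp

section \<open>Excess risk as a sum over cells\<close>

text \<open>If \<open>\<phi>\<close> were -\<infinity>, constants of ever smaller mixed loss on a
  cell of positive mass would drive the risk to -\<infinity>, against the finiteness of the minimal
  risk.\<close>

lemma \<phi>_finite:
  assumes w: "0 < w"
    and fin: "\<And>\<sigma>. \<sigma> \<in> sign_vectors m \<Longrightarrow> expected_risk l n (Ps \<sigma>) ghat - minimal_risk MX MY l (Ps \<sigma>) \<noteq> \<infinity>"
  shows "\<phi> MY l h1 h2 (edge_prob s) \<noteq> -\<infinity>"
proof -
  define \<sigma> :: "nat \<Rightarrow> bool" where "\<sigma> = (\<lambda>j\<in>{1..m}. s)"
  have \<sigma>: "\<sigma> \<in> sign_vectors m"
    unfolding \<sigma>_def by (rule sign_vector_const)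
  have one: "1 \<in> {1..m}" using m_pos by simp
  then have \<sigma>1: "\<sigma> 1 = s" by (simp add: \<sigma>_def)
  interpret \<mu>: prob_space \<mu> by (rule prob_\<mu>)
  have X: "XX 1 \<in> sets MX"
    using cells_sets[OF m_pos] .
  obtain r g where r: "minimal_risk MX MY l (Ps \<sigma>) = ereal r"
    and g: "g \<in> MX \<rightarrow>\<^sub>M MY" "\<bar>risk l (Ps \<sigma>) g\<bar> \<noteq> \<infinity>"
    by (rule regret_finiteD[OF \<sigma> fin[OF \<sigma>]])
  have cell: "(\<integral>\<^sup>+z. f z * indicator (XX 1 \<times> space MY) z \<partial>Ps \<sigma>)
      = (\<integral>\<^sup>+x. (ennreal (edge_prob s) * f (x, h1) + ennreal (1 - edge_prob s) * f (x, h2)) * indicator (XX 1) x \<partial>\<mu>)"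
    if "f \<in> borel_measurable (MX \<Otimes>\<^sub>M MY)" for f
    using one \<sigma>1 that by (intro nn_integral_cell[OF \<sigma> X]) auto
  note modify = loss_measurable Ps(2)[OF \<sigma>] \<mu>.finite_measure_axioms sets_\<mu>
  define L where "L = mixed_loss l h1 h2 (edge_prob s)"
  \<comment> \<open>Normalising the prediction to \<open>h1\<close> makes the mixed loss on the cell
    constant, which supplies the lower bound \<open>c = L h1\<close> required by
    \<open>risk_modify_le\<close>.\<close>
  define g0 where "g0 x = (if x \<in> XX 1 then h1 else g x)" for x
  have g0: "g0 \<in> MX \<rightarrow>\<^sub>M MY" "\<bar>risk l (Ps \<sigma>) g0\<bar> \<noteq> \<infinity>"
    unfolding g0_def
    using measurable_modify[OF modify g(1) X h_space edge_prob_bounds h_space(1) cell g(2)]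
      risk_modify_finite[OF modify g(1) X h_space edge_prob_bounds h_space(1) cell g(2)]
    by simp_all
  then obtain R0 where R0: "risk l (Ps \<sigma>) g0 = ereal R0" by auto
  have "L h1 + (r - R0) / w \<le> L y" if y: "y \<in> space MY" for y
  proof -
    define g1 where "g1 x = (if x \<in> XX 1 then y else g0 x)" for x
    have g1: "g1 \<in> MX \<rightarrow>\<^sub>M MY"
      unfolding g1_def
      by (rule measurable_modify[OF modify g0(1) X h_space edge_prob_bounds y cell g0(2)])
    have "risk l (Ps \<sigma>) g1 + enn2ereal (\<integral>\<^sup>+x. ennreal (L (g0 x) - L h1) * indicator (XX 1) x \<partial>\<mu>)
        \<le> risk l (Ps \<sigma>) g0 + ereal ((L y - L h1) * measure \<mu> (XX 1))"
      unfolding g1_def L_def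
      by (rule risk_modify_le[OF modify g0(1) X h_space edge_prob_bounds y cell g0(2)]) (simp_all add: g0_def)
    moreover have "risk l (Ps \<sigma>) g1 \<le> risk l (Ps \<sigma>) g1 + enn2ereal (\<integral>\<^sup>+x. ennreal (L (g0 x) - L h1) * indicator (XX 1) x \<partial>\<mu>)"
      by (rule ereal_le_add_self[OF enn2ereal_nonneg])
    moreover have "ereal r \<le> risk l (Ps \<sigma>) g1"
      using minimal_risk_le[OF g1, of "Ps \<sigma>"] by (simp add: r)
    ultimately have "ereal r \<le> risk l (Ps \<sigma>) g0 + ereal ((L y - L h1) * measure \<mu> (XX 1))"
      by (meson order_trans)
    then have "r \<le> R0 + (L y - L h1) * w"
      using cells_measure[OF one] by (simp add: R0)
    then show ?thesis
      using w by (simp add: field_simps)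
  qed
  then have "ereal (L h1 + (r - R0) / w) \<le> \<phi> MY l h1 h2 (edge_prob s)"
    unfolding \<phi>_def L_def mixed_loss_def by (intro INF_greatest) simp
  then show ?thesis by auto
qed

text \<open>Replacing \<open>g\<close> on all cells by nearly optimal constants gains almost the sum
  of the excess mixed losses, and the result still has risk at least \<open>r\<close>.\<close>

lemma risk_ge_cells:
  assumes \<sigma>: "\<sigma> \<in> sign_vectors m" and r: "minimal_risk MX MY l (Ps \<sigma>) = ereal r"
    and a: "\<And>s. \<phi> MY l h1 h2 (edge_prob s) = ereal (a s)" and g: "g \<in> MX \<rightarrow>\<^sub>M MY"
  shows "ereal r + enn2ereal (\<Sum>j\<in>{1..m}. \<integral>\<^sup>+x. ennreal (mixed_loss l h1 h2 (edge_prob (\<sigma> j)) (g x) - a (\<sigma> j)) * indicator (XX j) x \<partial>\<mu>)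
    \<le> risk l (Ps \<sigma>) g"
proof (cases "risk l (Ps \<sigma>) g = \<infinity>")
  case False
  define L where "L s = mixed_loss l h1 h2 (edge_prob s)" for s
  \<comment> \<open>Cells of equal sign share their label law, so two modifications replace an
    induction over the cells.\<close>
  define J where "J s = {j\<in>{1..m}. \<sigma> j = s}" for s
  define A where "A s = (\<Union>j\<in>J s. XX j)" for s
  define G where "G s = (\<integral>\<^sup>+x. ennreal (L s (g x) - a s) * indicator (A s) x \<partial>\<mu>)" for s
  interpret \<mu>: prob_space \<mu> by (rule prob_\<mu>)
  have J: "finite (J s)" "J s \<subseteq> {..m}" for s
    by (auto simp: J_def)
  have X: "XX j \<in> sets MX" if "j \<in> J s" for j s
    using cells_sets[of j] that by (simp add: J_def)
  have A: "A s \<in> sets MX" for s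
    unfolding A_def using X J by (intro sets.finite_UN) auto
  have disj: "x \<notin> A False" if "x \<in> A True" for x
  proof
    assume "x \<in> A False"
    with that obtain i j where ij: "i \<in> {1..m}" "\<sigma> i" "x \<in> XX i" "j \<in> {1..m}" "\<not> \<sigma> j" "x \<in> XX j"
      by (auto simp: A_def J_def)
    then have "XX i \<inter> XX j = {}"
      by (intro disjoint_family_onD[OF cells_disjoint]) auto
    with ij(3,6) show False by auto
  qed
  have L_ge: "a s \<le> L s y" if "y \<in> space MY" for s y
  proof -
    have "\<phi> MY l h1 h2 (edge_prob s) \<le> ereal (L s y)"
      unfolding \<phi>_def L_def mixed_loss_def using that by (rule INF_lower)
    then show ?thesis by (simp add: a)
  qed
  have g_meas: "g \<in> \<mu> \<rightarrow>\<^sub>M MY"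
    using g by (simp add: measurable_cong_sets[OF sets_\<mu> refl])
  have Lg_meas: "(\<lambda>x. L s (g x)) \<in> borel_measurable \<mu>" for s
    unfolding L_def by (rule measurable_compose[OF g_meas mixed_loss_measurable[OF loss_measurable h_space]])
  have g_space: "g x \<in> space MY" if "x \<in> A s" for x s
    using measurable_space[OF g] sets.sets_into_space[OF A] that by blast
  have G_sum: "(\<Sum>j\<in>J s. \<integral>\<^sup>+x. ennreal (L (\<sigma> j) (g x) - a (\<sigma> j)) * indicator (XX j) x \<partial>\<mu>) = G s" for s
  proof -
    have "(\<Sum>j\<in>J s. \<integral>\<^sup>+x. ennreal (L (\<sigma> j) (g x) - a (\<sigma> j)) * indicator (XX j) x \<partial>\<mu>)
        = (\<Sum>j\<in>J s. \<integral>\<^sup>+x. ennreal (L s (g x) - a s) * indicator (XX j) x \<partial>\<mu>)"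
      by (intro sum.cong) (auto simp: J_def)
    also have "\<dots> = (\<integral>\<^sup>+x. (\<Sum>j\<in>J s. ennreal (L s (g x) - a s) * indicator (XX j) x) \<partial>\<mu>)"
      using Lg_meas X[folded sets_\<mu>] by (intro nn_integral_sum[symmetric]) auto
    also have "\<dots> = G s"
      unfolding G_def A_def
      by (simp add: sum_distrib_left[symmetric] indicator_UN_disjoint[OF J(1) disjoint_family_on_mono[OF J(2) cells_disjoint]])
    finally show ?thesis .
  qed
  have "(\<Sum>j\<in>{1..m}. \<integral>\<^sup>+x. ennreal (L (\<sigma> j) (g x) - a (\<sigma> j)) * indicator (XX j) x \<partial>\<mu>)
      = (\<Sum>j\<in>J True \<union> J False. \<integral>\<^sup>+x. ennreal (L (\<sigma> j) (g x) - a (\<sigma> j)) * indicator (XX j) x \<partial>\<mu>)"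
    by (intro sum.cong) (auto simp: J_def)
  also have "\<dots> = G True + G False"
    by (subst sum.union_disjoint) (auto simp: G_sum J(1), auto simp: J_def)
  finally have sum_eq: "(\<Sum>j\<in>{1..m}. \<integral>\<^sup>+x. ennreal (L (\<sigma> j) (g x) - a (\<sigma> j)) * indicator (XX j) x \<partial>\<mu>) = G True + G False" .
  have fin: "\<bar>risk l (Ps \<sigma>) g\<bar> \<noteq> \<infinity>"
    using False minimal_risk_le[OF g, of "Ps \<sigma>"] r by auto
  then obtain R where R: "risk l (Ps \<sigma>) g = ereal R" by auto
  have cell: "(\<integral>\<^sup>+z. f z * indicator (A s \<times> space MY) z \<partial>Ps \<sigma>)
      = (\<integral>\<^sup>+x. (ennreal (edge_prob s) * f (x, h1) + ennreal (1 - edge_prob s) * f (x, h2)) * indicator (A s) x \<partial>\<mu>)"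
    if "f \<in> borel_measurable (MX \<Otimes>\<^sub>M MY)" for f s
    by (rule nn_integral_cell[OF \<sigma> A _ that]) (auto simp: A_def J_def)
  note modify = loss_measurable Ps(2)[OF \<sigma>] \<mu>.finite_measure_axioms sets_\<mu>
  \<comment> \<open>The infimum in \<open>\<phi>\<close> need not be attained. Each sign is allowed
    an error \<open>e / 2\<close>, which is not enlarged by integration because \<mu> has mass
    1.\<close>
  have "ereal r + enn2ereal (G True + G False) \<le> ereal R + ereal e" if e: "0 < e" for e
  proof -
    have "\<exists>y\<in>space MY. L s y \<le> a s + e / 2" for s
    proof -
      have "\<phi> MY l h1 h2 (edge_prob s) < ereal (a s + e / 2)"
        using e by (simp add: a)
      then show ?thesis
        unfolding \<phi>_def INF_less_iff L_def mixed_loss_def by (auto intro: less_imp_le)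
    qed
    then obtain y where y: "\<And>s. y s \<in> space MY" "\<And>s. L s (y s) \<le> a s + e / 2"
      by metis
    have mass: "(L s (y s) - a s) * measure \<mu> (A s) \<le> e / 2" for s
    proof -
      have "(L s (y s) - a s) * measure \<mu> (A s) \<le> e / 2 * 1"
        using y(2)[of s] e by (intro mult_mono) auto
      then show ?thesis by simp
    qed
    define g1 where "g1 = (\<lambda>x. if x \<in> A True then y True else g x)"
    have g1: "g1 \<in> MX \<rightarrow>\<^sub>M MY" and fin1: "\<bar>risk l (Ps \<sigma>) g1\<bar> \<noteq> \<infinity>"
      using measurable_modify[OF modify g A h_space edge_prob_bounds y(1) cell fin]
        risk_modify_finite[OF modify g A h_space edge_prob_bounds y(1) cell fin]
      unfolding g1_def by simp_all
    have le1: "risk l (Ps \<sigma>) g1 + enn2ereal (G True)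
        \<le> risk l (Ps \<sigma>) g + ereal ((L True (y True) - a True) * measure \<mu> (A True))"
      unfolding g1_def G_def L_def
      by (rule risk_modify_le[OF modify g A h_space edge_prob_bounds y(1) cell fin])
        (simp_all add: L_ge[unfolded L_def] g_space)
    obtain R1 where R1: "risk l (Ps \<sigma>) g1 = ereal R1" using fin1 by auto
    \<comment> \<open>The second modification starts from the first. The two unions of cells are
      disjoint, so \<open>g1\<close> still equals \<open>g\<close> where \<open>g2\<close> changes
      it.\<close>
    define g2 where "g2 = (\<lambda>x. if x \<in> A False then y False else g1 x)"
    have g2: "g2 \<in> MX \<rightarrow>\<^sub>M MY" and fin2: "\<bar>risk l (Ps \<sigma>) g2\<bar> \<noteq> \<infinity>"
      using measurable_modify[OF modify g1 A h_space edge_prob_bounds y(1) cell fin1]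
        risk_modify_finite[OF modify g1 A h_space edge_prob_bounds y(1) cell fin1]
      unfolding g2_def by simp_all
    have same: "g1 x = g x" if "x \<in> A False" for x
      using that disj by (auto simp: g1_def)
    have "G False = (\<integral>\<^sup>+x. ennreal (L False (g1 x) - a False) * indicator (A False) x \<partial>\<mu>)"
      unfolding G_def by (intro nn_integral_cong) (auto simp: same split: split_indicator)
    then have le2: "risk l (Ps \<sigma>) g2 + enn2ereal (G False)
        \<le> risk l (Ps \<sigma>) g1 + ereal ((L False (y False) - a False) * measure \<mu> (A False))"
      unfolding g2_def L_def
      by (simp only:) (rule risk_modify_le[OF modify g1 A h_space edge_prob_bounds y(1) cell fin1],
        simp_all add: L_ge[unfolded L_def] g_space same)
    obtain R2 where R2: "risk l (Ps \<sigma>) g2 = ereal R2" using fin2 by auto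
    have "r \<le> R2"
      using minimal_risk_le[OF g2, of "Ps \<sigma>"] by (simp add: r R2)
    moreover obtain i1 where i1: "G True = ennreal i1" "0 \<le> i1"
      using le1 R R1 by (cases "G True") auto
    moreover obtain i2 where i2: "G False = ennreal i2" "0 \<le> i2"
      using le2 R1 R2 by (cases "G False") auto
    ultimately show ?thesis
      using le1 le2 mass[of True] mass[of False] unfolding R R1 R2
      by (simp add: enn2ereal_ennreal ennreal_plus[symmetric] del: ennreal_plus)
  qed
  then have "ereal r + enn2ereal (G True + G False) \<le> ereal R"
    by (rule ereal_le_epsilon2)
  then show ?thesis
    by (simp only: R sum_eq[symmetric] L_def)
qed simp

section \<open>Averaging over the sign vectors\<close>

text \<open>For each cell, the sign vectors are paired by flipping that coordinate. Each pair
  contributes at least \<open>2 * D * w\<close> times the overlap to the excess on the cell, while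
  the excess summed over the cells never exceeds \<open>S\<close>.\<close>

lemma overlap_le_regret:
  assumes S: "S \<noteq> \<infinity>" "\<And>\<sigma>. \<sigma> \<in> sign_vectors m \<Longrightarrow> expected_risk l n (Ps \<sigma>) ghat - minimal_risk MX MY l (Ps \<sigma>) \<le> S"
    and a: "\<And>s. \<phi> MY l h1 h2 (edge_prob s) = ereal (a s)"
    and D: "0 \<le> D"
    and gap: "\<And>y. y \<in> space MY \<Longrightarrow> 2 * D \<le> (mixed_loss l h1 h2 p_plus y - a True) + (mixed_loss l h1 h2 p_minus y - a False)"
  shows "ereal (m * w * D * overlap w p_plus p_minus n 1 1) \<le> S"
proof -
  interpret \<mu>: prob_space \<mu> by (rule prob_\<mu>)
  let ?T = "PiM {..<n} (\<lambda>_. MX \<Otimes>\<^sub>M MY)"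
  define L where "L s = mixed_loss l h1 h2 (edge_prob s)" for s
  \<comment> \<open>\<open>B s j z\<close> is the excess on cell \<open>j\<close> of the prediction
    trained on \<open>z\<close> when the sign is \<open>s\<close>; \<open>T\<close> is its mean over
    training sets.\<close>
  define B where "B s j z = (\<integral>\<^sup>+x. ennreal (L s (ghat z x) - a s) * indicator (XX j) x \<partial>\<mu>)" for s j z
  define T where "T \<sigma> j = (\<integral>\<^sup>+z. B (\<sigma> j) j z \<partial>PiM {..<n} (\<lambda>_. Ps \<sigma>))" for \<sigma> j
  define ov where "ov = overlap w p_plus p_minus n 1 1"
  have ov: "0 \<le> ov"
    unfolding ov_def using w_bounds p_bounds by (intro overlap_nonneg) auto
  have L_meas: "L s \<in> borel_measurable MY" for s
    unfolding L_def by (rule mixed_loss_measurable[OF loss_measurable h_space])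
  have X: "XX j \<in> sets \<mu>" if "j \<in> {1..m}" for j
    using cells_sets[of j] that by (simp add: sets_\<mu>)
  have B_meas: "B s j \<in> borel_measurable ?T" if j: "j \<in> {1..m}" for s j
  proof -
    have "(\<lambda>u. L s (case u of (z, x) \<Rightarrow> ghat z x)) \<in> borel_measurable (?T \<Otimes>\<^sub>M \<mu>)"
      unfolding measurable_cong_sets[OF sets_pair_measure_cong[OF refl sets_\<mu>] refl]
      by (rule measurable_compose[OF estimator[unfolded estimator_def] L_meas])
    then have "(\<lambda>(z, x). ennreal (L s (ghat z x) - a s) * indicator (XX j) x) \<in> borel_measurable (?T \<Otimes>\<^sub>M \<mu>)"
      using X[OF j] by (simp add: split_def)
    then show ?thesis
      unfolding B_def by (rule \<mu>.borel_measurable_nn_integral)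
  qed
  have sum_T: "enn2ereal (\<Sum>j\<in>{1..m}. T \<sigma> j) \<le> S" if \<sigma>: "\<sigma> \<in> sign_vectors m" for \<sigma>
  proof -
    have "expected_risk l n (Ps \<sigma>) ghat - minimal_risk MX MY l (Ps \<sigma>) \<noteq> \<infinity>"
      using S(1) S(2)[OF \<sigma>] by auto
    then obtain r where r: "minimal_risk MX MY l (Ps \<sigma>) = ereal r"
      using regret_finiteD[OF \<sigma>] by blast
    have "enn2ereal (\<integral>\<^sup>+z. (\<Sum>j\<in>{1..m}. B (\<sigma> j) j z) \<partial>PiM {..<n} (\<lambda>_. Ps \<sigma>))
        \<le> expected_risk l n (Ps \<sigma>) ghat - minimal_risk MX MY l (Ps \<sigma>)"
    proof (rule regret_ge[OF \<sigma> r])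
      show "(\<lambda>z. \<Sum>j\<in>{1..m}. B (\<sigma> j) j z) \<in> borel_measurable ?T"
        using B_meas by (intro borel_measurable_sum) auto
      show "ereal r + enn2ereal (\<Sum>j\<in>{1..m}. B (\<sigma> j) j z) \<le> risk l (Ps \<sigma>) (ghat z)"
        if "z \<in> space ?T" for z
        unfolding B_def L_def by (rule risk_ge_cells[OF \<sigma> r a ghat_measurable[OF that]])
    qed
    also have "(\<integral>\<^sup>+z. (\<Sum>j\<in>{1..m}. B (\<sigma> j) j z) \<partial>PiM {..<n} (\<lambda>_. Ps \<sigma>)) = (\<Sum>j\<in>{1..m}. T \<sigma> j)"
      unfolding T_def
      by (intro nn_integral_sum) (simp add: B_meas measurable_cong_sets[OF sets_training[OF \<sigma>] refl])
    finally show ?thesis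
      using S(2)[OF \<sigma>] by (rule order_trans)
  qed
  have subadd: "ennreal (u + v) \<le> ennreal u + ennreal v" for u v
    by (cases "0 \<le> u"; cases "0 \<le> v") (auto simp: ennreal_neg intro!: ennreal_leI)
  \<comment> \<open>For a fixed training set the prediction is the same under both signs, so the
    pointwise gap can be integrated over the cell.\<close>
  have B_add: "ennreal (2 * D * w) \<le> B True j z + B False j z" if j: "j \<in> {1..m}" and z: "z \<in> space ?T" for j z
  proof -
    have "(\<lambda>x. L s (ghat z x)) \<in> borel_measurable \<mu>" for s
      unfolding measurable_cong_sets[OF sets_\<mu> refl]
      by (rule measurable_compose[OF ghat_measurable[OF z] L_meas])
    then have "B True j z + B False j z = (\<integral>\<^sup>+x. ennreal (L True (ghat z x) - a True) * indicator (XX j) x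
        + ennreal (L False (ghat z x) - a False) * indicator (XX j) x \<partial>\<mu>)"
      unfolding B_def using X[OF j] by (intro nn_integral_add[symmetric]) auto
    also have "(\<integral>\<^sup>+x. ennreal (2 * D) * indicator (XX j) x \<partial>\<mu>) \<le> \<dots>"
    proof (rule nn_integral_mono)
      fix x assume "x \<in> space \<mu>"
      then have "ghat z x \<in> space MY"
        using measurable_space[OF ghat_measurable[OF z]] by (simp add: space_\<mu>)
      then have "2 * D \<le> (L True (ghat z x) - a True) + (L False (ghat z x) - a False)"
        using gap by (simp add: L_def edge_prob_def)
      then have "ennreal (2 * D) \<le> ennreal (L True (ghat z x) - a True) + ennreal (L False (ghat z x) - a False)"
        by (rule order_trans[OF ennreal_leI subadd])
      then show "ennreal (2 * D) * indicator (XX j) x \<le> ennreal (L True (ghat z x) - a True) * indicator (XX j) x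
        + ennreal (L False (ghat z x) - a False) * indicator (XX j) x"
        by (auto split: split_indicator)
    qed
    also have "(\<integral>\<^sup>+x. ennreal (2 * D) * indicator (XX j) x \<partial>\<mu>) = ennreal (2 * D * w)"
      using X[OF j] D cells_measure[OF j] w_bounds
      by (simp add: nn_integral_cmult_indicator \<mu>.emeasure_eq_measure ennreal_mult)
    finally show ?thesis .
  qed
  have pair: "ennreal (2 * D * w) * ennreal ov \<le> T \<sigma> j + T (\<sigma>(j := False)) j"
    if \<sigma>: "\<sigma> \<in> sign_vectors m" and j: "j \<in> {1..m}" and \<sigma>j: "\<sigma> j" for \<sigma> j
    using overlap_flip[OF \<sigma> j \<sigma>j B_meas[OF j, of True] B_meas[OF j, of False] B_add[OF j]] \<sigma>j
    by (simp add: T_def ov_def)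
  define flip :: "nat \<Rightarrow> (nat \<Rightarrow> bool) \<Rightarrow> nat \<Rightarrow> bool" where "flip j \<sigma> = \<sigma>(j := \<not> \<sigma> j)" for j \<sigma>
  have flip_pair: "ennreal (2 * D * w) * ennreal ov \<le> T \<sigma> j + T (flip j \<sigma>) j"
    if \<sigma>: "\<sigma> \<in> sign_vectors m" and j: "j \<in> {1..m}" for \<sigma> j
  proof (cases "\<sigma> j")
    case True
    then show ?thesis using pair[OF \<sigma> j] by (simp add: flip_def)
  next
    case False
    then have "(\<sigma>(j := True))(j := False) = \<sigma>" by (auto simp: fun_eq_iff)
    then show ?thesis
      using pair[OF sign_vector_upd[OF \<sigma> j, of True] j] False by (simp add: flip_def add.commute)
  qed
  \<comment> \<open>Flipping a coordinate is an involution on the sign vectors.\<close>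
  have flip_sum: "(\<Sum>\<sigma>\<in>sign_vectors m. T (flip j \<sigma>) j) = (\<Sum>\<sigma>\<in>sign_vectors m. T \<sigma> j)"
    if j: "j \<in> {1..m}" for j
    by (rule sum.reindex_bij_witness[where i = "flip j" and j = "flip j"])
      (auto simp: flip_def sign_vector_upd[OF _ j])
  define N where "N = card (sign_vectors m)"
  have fin: "finite (sign_vectors m)"
    unfolding sign_vectors_def by (intro finite_PiE) auto
  have N: "0 < N"
    unfolding N_def using fin sign_vector_const by (auto simp: card_gt_0_iff)
  have S0: "0 \<le> S"
    using order_trans[OF regret_nonneg S(2)] sign_vector_const by blast
  then obtain s where s: "S = ereal s" "0 \<le> s"
    using S(1) by (cases S) auto
  have sum_le: "(\<Sum>j\<in>{1..m}. T \<sigma> j) \<le> ennreal s" if "\<sigma> \<in> sign_vectors m" for \<sigma>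
    using sum_T[OF that] s by (metis e2ennreal_enn2ereal e2ennreal_ereal e2ennreal_mono)
  \<comment> \<open>Double counting: summing over all \<sigma> meets each pair twice, and this
    factor 2 cancels the one in \<open>2 * D * w\<close>.\<close>
  have "of_nat m * (of_nat N * (ennreal (2 * D * w) * ennreal ov))
      = (\<Sum>j\<in>{1..m}. \<Sum>\<sigma>\<in>sign_vectors m. ennreal (2 * D * w) * ennreal ov)"
    by (simp add: N_def)
  also have "\<dots> \<le> (\<Sum>j\<in>{1..m}. \<Sum>\<sigma>\<in>sign_vectors m. T \<sigma> j + T (flip j \<sigma>) j)"
    using flip_pair by (intro sum_mono) auto
  also have "\<dots> = 2 * (\<Sum>j\<in>{1..m}. \<Sum>\<sigma>\<in>sign_vectors m. T \<sigma> j)"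
    by (simp add: sum.distrib flip_sum mult_2 del: sum.cl_ivl_Suc)
  also have "(\<Sum>j\<in>{1..m}. \<Sum>\<sigma>\<in>sign_vectors m. T \<sigma> j) = (\<Sum>\<sigma>\<in>sign_vectors m. \<Sum>j\<in>{1..m}. T \<sigma> j)"
    by (rule sum.swap)
  also have "2 * \<dots> \<le> 2 * (\<Sum>\<sigma>\<in>sign_vectors m. ennreal s)"
    using sum_le by (intro mult_left_mono sum_mono) auto
  also have "\<dots> = of_nat N * (2 * ennreal s)"
    by (simp add: N_def ac_simps)
  finally have "ennreal (real m * (real N * ((2 * D * w) * ov))) \<le> ennreal (real N * (2 * s))"
    using s(2) D ov w_bounds by (simp add: ennreal_mult ennreal_of_nat_eq_real_of_nat)
  then have "real m * (real N * ((2 * D * w) * ov)) \<le> real N * (2 * s)"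
    using s(2) by (simp add: ennreal_le_iff)
  then have "real N * (2 * (real m * w * D * ov)) \<le> real N * (2 * s)"
    by (simp add: ac_simps)
  then have "real m * w * D * ov \<le> s"
    using N by (simp add: mult_le_cancel_left_pos)
  then show ?thesis
    by (simp add: s(1) ov_def)
qed

end

section \<open>From the overlap to the supremum of the regrets\<close>

text \<open>The comparison of the two bounds is the Bernoulli inequality with exponent
  \<open>n * w\<close>, which reverses for \<open>n * w < 1\<close>. It is therefore stated for
  \<open>n * w \<ge> 1\<close>, and the bound with \<open>sqrt (n * w * d_II)\<close> is asserted
  separately.\<close>

theorem theorem8p2:
  fixes MX :: "'x measure" and MY :: "'y measure"
    and l :: "'y \<Rightarrow> 'y \<Rightarrow> real"
    and PP :: "('x \<times> 'y) measure set"
    and Ps :: "(nat \<Rightarrow> bool) \<Rightarrow> ('x \<times> 'y) measure"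
    and \<mu> :: "'x measure" and XX :: "nat \<Rightarrow> 'x set" and h1 h2 :: 'y
    and m n :: nat and p_plus p_minus w d_II :: real and d_I :: ereal
    and ghat :: "(nat \<Rightarrow> 'x \<times> 'y) \<Rightarrow> 'x \<Rightarrow> 'y"
  assumes loss_measurable: "(\<lambda>(y, y'). l y y') \<in> borel_measurable (MY \<Otimes>\<^sub>M MY)"
    and distributions: "\<And>P. P \<in> PP \<Longrightarrow> prob_space P \<and> sets P = sets (MX \<Otimes>\<^sub>M MY)"
    and hypercube: "hypercube MX MY m Ps \<mu> XX h1 h2 p_plus p_minus w"
    and contained: "Ps ` sign_vectors m \<subseteq> PP"
    and d_I: "d_I = edge_discrepancy_I MY l h1 h2 p_plus p_minus"
    and d_II: "d_II = edge_discrepancy_II p_plus p_minus"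
    and estimator: "estimator MX MY n ghat"
    and n: "n \<ge> 1"
  shows
    "(SUP P\<in>PP. expected_risk l n P ghat - minimal_risk MX MY l P)
       \<ge> ereal (m * w) * d_I * ereal (1 - sqrt (1 - (1 - d_II) powr (n * w)))
     \<and> (n * w \<ge> 1 \<longrightarrow>
          ereal (m * w) * d_I * ereal (1 - sqrt (1 - (1 - d_II) powr (n * w)))
            \<ge> ereal (m * w) * d_I * ereal (1 - sqrt (n * w * d_II)))
     \<and> (SUP P\<in>PP. expected_risk l n P ghat - minimal_risk MX MY l P)
       \<ge> ereal (m * w) * d_I * ereal (1 - sqrt (n * w * d_II))
     \<and> (p_plus = 1 \<and> 1 = 1 - p_minus \<longrightarrow>
          (SUP P\<in>PP. expected_risk l n P ghat - minimal_risk MX MY l P)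
            \<ge> ereal (m * w) * d_I * ereal ((1 - w) ^ n))"
proof -
  interpret hypercube_estimation MX MY l Ps \<mu> XX h1 h2 m n p_plus p_minus w ghat
    using loss_measurable hypercube estimator by unfold_locales
  have pq: "0 \<le> p_plus" "p_plus \<le> 1" "0 \<le> p_minus" "p_minus \<le> 1"
    using p_bounds by auto
  have d: "0 \<le> d_II" "d_II \<le> 1"
    unfolding d_II by (rule edge_discrepancy_II_bounds[OF pq])+
  define S where "S = (SUP P\<in>PP. expected_risk l n P ghat - minimal_risk MX MY l P)"
  have S: "expected_risk l n (Ps \<sigma>) ghat - minimal_risk MX MY l (Ps \<sigma>) \<le> S" if "\<sigma> \<in> sign_vectors m" for \<sigma>
    unfolding S_def using contained that by (intro SUP_upper) auto
  have S0: "0 \<le> S"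
    using order_trans[OF regret_nonneg S] sign_vector_const by blast
  have MY_ne: "space MY \<noteq> {}"
    using h_space by auto
  have d_I_nonneg: "0 \<le> d_I"
    unfolding d_I by (rule edge_discrepancy_I_cases[OF MY_ne pq, of l h1 h2]) auto
  \<comment> \<open>Any lower bound \<open>k\<close> for the overlap gives a bound on the regret.
    For \<open>w = 0\<close> the left side is 0 even if \<open>d_I\<close> is infinite, since 0
    times \<infinity> is 0 in \<open>ereal\<close>.\<close>
  have main: "ereal (m * w) * d_I * ereal k \<le> S" if k: "0 < w \<Longrightarrow> k \<le> overlap w p_plus p_minus n 1 1" for k
  proof (cases "w = 0 \<or> S = \<infinity>")
    case True
    then show ?thesis using S0 by (auto simp: zero_ereal_def[symmetric])
  next
    case False
    then have w: "0 < w" and S_fin: "S \<noteq> \<infinity>"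
      using w_bounds by auto
    have fin: "expected_risk l n (Ps \<sigma>) ghat - minimal_risk MX MY l (Ps \<sigma>) \<noteq> \<infinity>"
      if "\<sigma> \<in> sign_vectors m" for \<sigma>
      using S[OF that] S_fin by auto
    have \<phi>_fin: "\<phi> MY l h1 h2 (edge_prob s) \<noteq> -\<infinity>" for s
      by (rule \<phi>_finite[OF w fin])
    show ?thesis
    proof (rule edge_discrepancy_I_cases[OF MY_ne pq, of l h1 h2])
      assume "\<phi> MY l h1 h2 p_plus = -\<infinity> \<or> \<phi> MY l h1 h2 p_minus = -\<infinity>"
      then show ?thesis
        using \<phi>_fin[of True] \<phi>_fin[of False] by (simp add: edge_prob_def)
    next
      fix a b D
      assume D: "edge_discrepancy_I MY l h1 h2 p_plus p_minus = ereal D" "0 \<le> D"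
        and \<phi>: "\<phi> MY l h1 h2 p_plus = ereal a" "\<phi> MY l h1 h2 p_minus = ereal b"
        and gap: "\<And>y. y \<in> space MY \<Longrightarrow> 2 * D \<le> mixed_loss l h1 h2 p_plus y - a + (mixed_loss l h1 h2 p_minus y - b)"
      have "ereal (m * w) * d_I * ereal k \<le> ereal (m * w * D * overlap w p_plus p_minus n 1 1)"
        using k[OF w] w D(2) by (simp add: d_I D(1) mult_left_mono)
      also have "\<dots> \<le> S"
        by (rule overlap_le_regret[OF S_fin S, where a = "\<lambda>s. if s then a else b"])
          (use \<phi> D(2) gap in \<open>auto simp: edge_prob_def\<close>)
      finally show ?thesis .
    qed
  qed
  have "1 - sqrt (n * w * d_II) \<le> 1 - sqrt (1 - (1 - d_II) powr (n * w))" if "1 \<le> n * w"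
    using one_minus_mult_le_powr[OF d that] by simp
  then have "ereal (m * w) * d_I * ereal (1 - sqrt (n * w * d_II))
      \<le> ereal (m * w) * d_I * ereal (1 - sqrt (1 - (1 - d_II) powr (n * w)))" if "1 \<le> n * w"
    using that d_I_nonneg w_bounds by (intro ereal_mult_left_mono) auto
  moreover have "(1 - w) ^ n \<le> overlap w p_plus p_minus n 1 1"
    using overlap_ge_power[OF w_bounds pq, of 1 1 n] by simp
  ultimately show ?thesis
    using main one_minus_le_overlap[OF _ w_bounds(2) pq n] unfolding S_def[symmetric] d_II[symmetric] by auto
qed

end
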